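(* Let $(\mathbf x_1,-\mathbf e_z)$ be the end condition of $\mathbf{P_{curve}}$ with the initial condition $(\mathbf 0,\mathbf e_z)$. Then a solution to problem $\mathbf{P_{curve}}$ exists if and only if $\mathbf x_1\cdot\mathbf e_z=0$. Moreover, this condition is only possible for curves departing from a cusp and ending in a cusp.
   Context: $\mathbf{P_{curve}}$ (with $\xi=1$): minimize $\int_0^L\sqrt{1+\kappa^2(s)}\,ds$ ($L\ge0$ free, $\kappa$ the absolute curvature) among smooth arclength-parametrized curves $\mathbf x$ in $\mathbb R^3$ with $\mathbf x(0)=\mathbf 0$, $\mathbf x'(0)=\mathbf e_z$, $\mathbf x(L)=\mathbf x_1$, $\mathbf x'(L)=\mathbf n_1\in S^2$ (here $\mathbf n_1=-\mathbf e_z$). Its stationary curves are the curves $\mathbf x$ on $[0,L]$, $L\le s_{max}$, obtained as spatial projections of cuspless sub-Riemannian geodesics $\gamma=(\mathbf x,R)$ in $SE(3)=\mathbb R^3\rtimes SO(3)$ with sixth momentum component zero (end points at which the curvature tends to infinity, i.e. cusps at the end points, are allowed): the momentum is $\lambda_1(s)=\lambda_1(0)\cosh s-\lambda_5(0)\sinh s$, $\lambda_5(s)=\lambda_5(0)\cosh s-\lambda_1(0)\sinh s$, $\lambda_2(s)=\lambda_2(0)\cosh s+\lambda_4(0)\sinh s$, $\lambda_4(s)=\lambda_4(0)\cosh s+\lambda_2(0)\sinh s$, $\lambda_3(s)=\sqrt{1-\lambda_4(s)^2-\lambda_5(s)^2}$, with $(\lambda_1,\lambda_2,\lambda_3)(0)\ne\mathbf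 0$ and $\lambda_4(0)^2+\lambda_5(0)^2\le1$; $s_{max}\in(0,\infty]$ is the minimal $s>0$ with $\lambda_3(s)=0$; $\gamma(0)=(\mathbf 0,I)$ and for $0<s<s_{max}$ $$\mathbf x'(s)=R(s)\mathbf e_z,\qquad R'(s)=\frac1{\lambda_3(s)}R(s)\begin{pmatrix}0&0&\lambda_5(s)\\0&0&-\lambda_4(s)\\-\lambda_5(s)&\lambda_4(s)&0\end{pmatrix}.$$ The curve departs from a cusp if $\lambda_3(0)=0$ and ends in a cusp if $L=s_{max}$ (so $\lambda_3(L)=0$).
   Formalization: The condition x_1·e_z = 0 is replaced by "x_1·e_z = 0 and x_1 ≠ 0": for x_1 = 0 no solution exists, since p·x(s) (p the conserved spatial momentum) strictly increases along a stationary curve with end tangent -e_z, so x(L) ≠ 0. *)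

theory Defs
  imports "HOL-Analysis.Analysis"
begin

definition e_z :: "real^3" where
  "e_z = axis 3 1"

subsection \<open>The variational problem\<close>

definition smooth_on_open :: "(real \<Rightarrow> 'a::real_normed_vector) \<Rightarrow> real set \<Rightarrow> bool" where
  "smooth_on_open f S \<longleftrightarrow>
     (\<forall>k. ((\<lambda>g t. vector_derivative g (at t)) ^^ k) f differentiable_on S)"

text \<open>The curvature of a curve that is parametrized by arc length.\<close>

definition curvature :: "(real \<Rightarrow> real^3) \<Rightarrow> real \<Rightarrow> real" where
  "curvature x s = norm (vector_derivative (\<lambda>t. vector_derivative x (at t)) (at s))"

text \<open>
  The integrand is nonnegative, so the cost is an extended nonnegative real and needs no
  integrability assumption. The end points of the interval, where the curvature may be infinite,
  form a null set.
\<close>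

definition P_curve_cost :: "real \<Rightarrow> (real \<Rightarrow> real^3) \<Rightarrow> ennreal" where
  "P_curve_cost L x = (\<integral>\<^sup>+ s\<in>{0<..<L}. ennreal (sqrt (1 + (curvature x s)\<^sup>2)) \<partial>lborel)"

text \<open>
  Curves \<open>x\<close> on \<open>[0, L]\<close> from \<open>(0, e_z)\<close> to \<open>(x1, n1)\<close>, with tangent \<open>n = x'\<close>. The tangent is
  continuous up to the end points, but smoothness is required in the interior only, so that cusps
  at the end points are admitted. The tangent is an argument of its own because a derivative
  within \<open>{0..L}\<close> says nothing if \<open>L = 0\<close>; in that case the conditions below force \<open>n1 = e_z\<close>.
\<close>

definition P_curve_admissible ::
  "real^3 \<Rightarrow> real^3 \<Rightarrow> real \<Rightarrow> (real \<Rightarrow> real^3) \<Rightarrow> (real \<Rightarrow> real^3) \<Rightarrow> bool" where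
  "P_curve_admissible x1 n1 L x n \<longleftrightarrow>
     0 \<le> L \<and>
     (\<forall>s\<in>{0..L}. (x has_vector_derivative n s) (at s within {0..L})) \<and>
     (\<forall>s\<in>{0..L}. norm (n s) = 1) \<and>
     continuous_on {0..L} n \<and>
     smooth_on_open x {0<..<L} \<and>
     x 0 = 0 \<and> n 0 = e_z \<and> x L = x1 \<and> n L = n1"

subsection \<open>Cuspless sub-Riemannian geodesics\<close>

text \<open>
  The momentum components as functions of arc length. The arguments \<open>l1\<close>, \<open>l2\<close>, \<open>l4\<close>, \<open>l5\<close> are the
  values of the respective components at \<open>0\<close>.
\<close>

definition lam1 :: "real \<Rightarrow> real \<Rightarrow> real \<Rightarrow> real" where
  "lam1 l1 l5 s = l1 * cosh s - l5 * sinh s"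

definition lam5 :: "real \<Rightarrow> real \<Rightarrow> real \<Rightarrow> real" where
  "lam5 l1 l5 s = l5 * cosh s - l1 * sinh s"

definition lam2 :: "real \<Rightarrow> real \<Rightarrow> real \<Rightarrow> real" where
  "lam2 l2 l4 s = l2 * cosh s + l4 * sinh s"

definition lam4 :: "real \<Rightarrow> real \<Rightarrow> real \<Rightarrow> real" where
  "lam4 l2 l4 s = l4 * cosh s + l2 * sinh s"

definition lam3 :: "real \<Rightarrow> real \<Rightarrow> real \<Rightarrow> real \<Rightarrow> real \<Rightarrow> real" where
  "lam3 l1 l2 l4 l5 s = sqrt (1 - (lam4 l2 l4 s)\<^sup>2 - (lam5 l1 l5 s)\<^sup>2)"

text \<open>The value is \<open>\<infinity>\<close> if there is no zero.\<close>

definition s_max :: "real \<Rightarrow> real \<Rightarrow> real \<Rightarrow> real \<Rightarrow> ereal" where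
  "s_max l1 l2 l4 l5 = Inf (ereal ` {s. 0 < s \<and> lam3 l1 l2 l4 l5 s = 0})"

definition omega_mat :: "real \<Rightarrow> real \<Rightarrow> real^3^3" where
  "omega_mat m4 m5 = vector [vector [0, 0, m5], vector [0, 0, - m4], vector [- m5, m4, 0]]"

text \<open>
  The geodesic \<open>(x, R)\<close> on \<open>[0, L]\<close>, starting at the unit of \<open>SE(3)\<close>. As \<open>sqrt\<close> is total
  (and negative on negative arguments), the radicand of the third momentum component has to be
  required to be nonnegative; together with \<open>L \<le> s_max\<close> this makes the component positive on
  \<open>(0, L)\<close>. The differential equations hold in the interior only, since their right-hand side
  is singular at a cusp.
\<close>

definition sr_geodesic ::
  "real \<Rightarrow> real \<Rightarrow> real \<Rightarrow> real \<Rightarrow> real \<Rightarrow> (real \<Rightarrow> real^3) \<Rightarrow> (real \<Rightarrow> real^3^3) \<Rightarrow> bool" where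
  "sr_geodesic l1 l2 l4 l5 L x R \<longleftrightarrow>
     (l1, l2, lam3 l1 l2 l4 l5 0) \<noteq> (0, 0, 0) \<and>
     l4\<^sup>2 + l5\<^sup>2 \<le> 1 \<and>
     0 \<le> L \<and> ereal L \<le> s_max l1 l2 l4 l5 \<and>
     (\<forall>s\<in>{0..L}. (lam4 l2 l4 s)\<^sup>2 + (lam5 l1 l5 s)\<^sup>2 \<le> 1) \<and>
     continuous_on {0..L} x \<and> continuous_on {0..L} R \<and>
     (\<forall>s\<in>{0..L}. orthogonal_matrix (R s) \<and> det (R s) = 1) \<and>
     x 0 = 0 \<and> R 0 = mat 1 \<and>
     (\<forall>s\<in>{0<..<L}.
        (x has_vector_derivative R s *v e_z) (at s) \<and>
        (R has_vector_derivative
           (1 / lam3 l1 l2 l4 l5 s) *\<^sub>R (R s ** omega_mat (lam4 l2 l4 s) (lam5 l1 l5 s))) (at s))"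

definition departs_from_cusp :: "real \<Rightarrow> real \<Rightarrow> real \<Rightarrow> real \<Rightarrow> bool" where
  "departs_from_cusp l1 l2 l4 l5 \<longleftrightarrow> lam3 l1 l2 l4 l5 0 = 0"

definition ends_in_cusp :: "real \<Rightarrow> real \<Rightarrow> real \<Rightarrow> real \<Rightarrow> real \<Rightarrow> bool" where
  "ends_in_cusp l1 l2 l4 l5 L \<longleftrightarrow>
     ereal L = s_max l1 l2 l4 l5 \<and> lam3 l1 l2 l4 l5 L = 0"

subsection \<open>Stationary curves and solutions\<close>

definition P_curve_stationary ::
  "real^3 \<Rightarrow> real^3 \<Rightarrow> real \<Rightarrow> (real \<Rightarrow> real^3) \<Rightarrow> (real \<Rightarrow> real^3) \<Rightarrow> bool" where
  "P_curve_stationary x1 n1 L x n \<longleftrightarrow>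
     (\<exists>l1 l2 l4 l5 R. sr_geodesic l1 l2 l4 l5 L x R \<and> (\<forall>s\<in>{0..L}. n s = R s *v e_z)) \<and>
     x L = x1 \<and> n L = n1"

text \<open>
  A solution is a stationary curve that is a global minimizer of the cost among all admissible
  curves, of any length, with the same end condition.
\<close>

definition P_curve_solution ::
  "real^3 \<Rightarrow> real^3 \<Rightarrow> real \<Rightarrow> (real \<Rightarrow> real^3) \<Rightarrow> (real \<Rightarrow> real^3) \<Rightarrow> bool" where
  "P_curve_solution x1 n1 L x n \<longleftrightarrow>
     P_curve_admissible x1 n1 L x n \<and>
     P_curve_stationary x1 n1 L x n \<and>
     (\<forall>L' x' n'. P_curve_admissible x1 n1 L' x' n' \<longrightarrow> P_curve_cost L x \<le> P_curve_cost L' x')"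

end

theory Submission
  imports Defs "HOL-Real_Asymp.Real_Asymp"
begin

text \<open>
  The momentum \<open>p = R (\<lambda>\<^sub>1, \<lambda>\<^sub>2, \<lambda>\<^sub>3)\<close> is constant along a geodesic. If the tangent turns from
  \<open>e_z\<close> to \<open>- e_z\<close>, then \<open>\<lambda>\<^sub>3 = p \<bullet> x'\<close> takes opposite values at the two ends, and as it is
  nonnegative, both ends are cusps. Then \<open>p\<close> is horizontal, and conservation of angular momentum
  makes the end point horizontal. It is not \<open>0\<close> because \<open>p \<bullet> x\<close> is strictly increasing.

  Conversely, let \<open>e\<close> be a horizontal unit vector. For \<open>h > 0\<close> the planar curve of length \<open>2h\<close>
  with \<open>x' \<bullet> e_z = sinh (h - s) / sinh h\<close> is stationary, and its end point covers all \<open>d e\<close> with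
  \<open>d > 0\<close> by the intermediate value theorem. It is optimal by a calibration: with \<open>a = tanh h\<close>,
  \<open>w = x' \<bullet> e_z\<close>, and \<open>\<Gamma>' w = sqrt (1 - a\<^sup>2 (1 - w\<^sup>2)) / sqrt (1 - w\<^sup>2)\<close>, the derivative of
  \<open>a x \<bullet> e - \<Gamma> w\<close> is at most \<open>sqrt (1 + \<kappa>\<^sup>2)\<close> on every curve, with equality on this one. As \<open>\<Gamma>'\<close> is
  singular at the poles, \<open>1 - w\<^sup>2\<close> is replaced by \<open>\<bar>1 - w\<^sup>2\<bar> + \<epsilon>\<close> in the denominator.
\<close>

subsection \<open>Geodesics that reverse the tangent\<close>

lemma e_z_nth [simp]: "e_z $ 1 = 0" "e_z $ 2 = 0" "e_z $ 3 = 1"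
  by (simp_all add: e_z_def axis_def)

lemma inner_e_z: "v \<bullet> e_z = v $ 3"
  by (simp add: inner_vec_def sum_3)

lemma inner_vec3: "(v::real^3) \<bullet> w = v $ 1 * w $ 1 + v $ 2 * w $ 2 + v $ 3 * w $ 3"
  by (simp add: inner_vec_def sum_3)

lemma mult_e_z_nth: "(A *v e_z) $ i = A $ i $ (3::3)"
  by (simp add: matrix_vector_mult_def sum_3)

lemma orthogonal_matrix_inner:
  fixes A :: "real^'n^'n"
  assumes "orthogonal_matrix A"
  shows "(A *v v) \<bullet> (A *v w) = v \<bullet> w"
proof -
  have "orthogonal_transformation ((*v) A)"
    using assms by (simp add: orthogonal_transformation_matrix)
  then show ?thesis by (simp add: orthogonal_transformation_def)
qed

section \<open>Momentum components and their invariants\<close>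

lemma DERIV_lam1: "(lam1 l1 l5 has_real_derivative - lam5 l1 l5 s) (at s)"
  and DERIV_lam5: "(lam5 l1 l5 has_real_derivative - lam1 l1 l5 s) (at s)"
  and DERIV_lam2: "(lam2 l2 l4 has_real_derivative lam4 l2 l4 s) (at s)"
  and DERIV_lam4: "(lam4 l2 l4 has_real_derivative lam2 l2 l4 s) (at s)"
  unfolding lam1_def [abs_def] lam5_def [abs_def] lam2_def [abs_def] lam4_def [abs_def]
  by (auto intro!: derivative_eq_intros)

lemma continuous_on_lam:
  "continuous_on S (lam1 l1 l5)" "continuous_on S (lam5 l1 l5)"
  "continuous_on S (lam2 l2 l4)" "continuous_on S (lam4 l2 l4)"
  "continuous_on S (lam3 l1 l2 l4 l5)"
  unfolding lam1_def [abs_def] lam5_def [abs_def] lam2_def [abs_def] lam4_def [abs_def]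
    lam3_def [abs_def]
  by (auto intro!: continuous_intros)

lemma lam_0 [simp]:
  "lam1 l1 l5 0 = l1" "lam5 l1 l5 0 = l5" "lam2 l2 l4 0 = l2" "lam4 l2 l4 0 = l4"
  by (simp_all add: lam1_def lam2_def lam4_def lam5_def)

definition momentum :: "real \<Rightarrow> real \<Rightarrow> real \<Rightarrow> real \<Rightarrow> real \<Rightarrow> real^3" where
  "momentum l1 l2 l4 l5 s = vector [lam1 l1 l5 s, lam2 l2 l4 s, lam3 l1 l2 l4 l5 s]"

lemma momentum_nth [simp]:
  "momentum l1 l2 l4 l5 s $ 1 = lam1 l1 l5 s"
  "momentum l1 l2 l4 l5 s $ 2 = lam2 l2 l4 s"
  "momentum l1 l2 l4 l5 s $ 3 = lam3 l1 l2 l4 l5 s"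
  by (simp_all add: momentum_def)

lemma lam1_lam5_invariant: "(lam1 l1 l5 s)\<^sup>2 - (lam5 l1 l5 s)\<^sup>2 = l1\<^sup>2 - l5\<^sup>2"
proof -
  have "(lam1 l1 l5 s)\<^sup>2 - (lam5 l1 l5 s)\<^sup>2 = (l1\<^sup>2 - l5\<^sup>2) * ((cosh s)\<^sup>2 - (sinh s)\<^sup>2)"
    unfolding lam1_def lam5_def by algebra
  then show ?thesis by (simp add: cosh_square_eq)
qed

lemma lam2_lam4_invariant: "(lam2 l2 l4 s)\<^sup>2 - (lam4 l2 l4 s)\<^sup>2 = l2\<^sup>2 - l4\<^sup>2"
proof -
  have "(lam2 l2 l4 s)\<^sup>2 - (lam4 l2 l4 s)\<^sup>2 = (l2\<^sup>2 - l4\<^sup>2) * ((cosh s)\<^sup>2 - (sinh s)\<^sup>2)"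
    unfolding lam2_def lam4_def by algebra
  then show ?thesis by (simp add: cosh_square_eq)
qed

text \<open>\<open>lam4\<^sup>2 + lam5\<^sup>2\<close> is a constant plus a combination of
  \<open>cosh (2 * s)\<close> and \<open>sinh (2 * s)\<close>. Such a function with equal values at
  two points is symmetric about their midpoint, so its derivatives there are opposite; the
  conclusion compares half of these derivatives.\<close>

lemma cusp_symmetry:
  assumes "0 < s" and "(lam4 l2 l4 s)\<^sup>2 + (lam5 l1 l5 s)\<^sup>2 = l4\<^sup>2 + l5\<^sup>2"
  shows "lam4 l2 l4 s * lam2 l2 l4 s - lam5 l1 l5 s * lam1 l1 l5 s = - (l4 * l2 - l5 * l1)"
proof -
  define A where "A = l1\<^sup>2 + l2\<^sup>2 + l4\<^sup>2 + l5\<^sup>2"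
  define B where "B = l4 * l2 - l5 * l1"
  define C where "C = cosh s"
  define S where "S = sinh s"
  have CS: "C\<^sup>2 = S\<^sup>2 + 1" unfolding C_def S_def by (rule cosh_square_eq)
  have "S > 0" unfolding S_def using assms(1) by simp
  \<comment> \<open>The left side is the increment of \<open>lam4\<^sup>2 + lam5\<^sup>2\<close>
    from 0 to \<open>s\<close>.\<close>
  have "S * (A * S + 2 * B * C) = 0"
    using assms(2) CS unfolding A_def B_def lam4_def lam5_def C_def [symmetric] S_def [symmetric]
    by algebra
  with \<open>S > 0\<close> have AB: "A * S = - (2 * B * C)" by auto
  have "(l4 * C + l2 * S) * (l2 * C + l4 * S) - (l5 * C - l1 * S) * (l1 * C - l5 * S)
      = B * (C\<^sup>2 + S\<^sup>2) + A * S * C"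
    unfolding A_def B_def by algebra
  also have "\<dots> = - B" using CS AB by algebra
  finally show ?thesis unfolding lam1_def lam2_def lam4_def lam5_def B_def C_def S_def .
qed

lemma DERIV_lam3:
  assumes "lam3 l1 l2 l4 l5 s > 0"
  shows "(lam3 l1 l2 l4 l5 has_real_derivative
    (lam5 l1 l5 s * lam1 l1 l5 s - lam4 l2 l4 s * lam2 l2 l4 s) / lam3 l1 l2 l4 l5 s) (at s)"
proof -
  have pos: "1 - (lam4 l2 l4 s)\<^sup>2 - (lam5 l1 l5 s)\<^sup>2 > 0"
    using assms by (simp add: lam3_def)
  have "((\<lambda>s. 1 - (lam4 l2 l4 s)\<^sup>2 - (lam5 l1 l5 s)\<^sup>2) has_real_derivative
      2 * (lam5 l1 l5 s * lam1 l1 l5 s - lam4 l2 l4 s * lam2 l2 l4 s)) (at s)"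
    by (rule derivative_eq_intros DERIV_lam4 DERIV_lam5 refl | simp)+
  from DERIV_chain2 [OF DERIV_real_sqrt [OF pos] this] show ?thesis
    unfolding lam3_def [abs_def] by (rule DERIV_cong) (simp add: divide_simps)
qed

lemma lam3_sq:
  assumes "(lam4 l2 l4 s)\<^sup>2 + (lam5 l1 l5 s)\<^sup>2 \<le> 1"
  shows "(lam3 l1 l2 l4 l5 s)\<^sup>2 = 1 - (lam4 l2 l4 s)\<^sup>2 - (lam5 l1 l5 s)\<^sup>2"
  unfolding lam3_def using assms by simp

text \<open>As \<open>lam3\<^sup>2 = 1 - lam4\<^sup>2 - lam5\<^sup>2\<close>, the sum is 1 plus the
  two hyperbolic invariants.\<close>

lemma norm_momentum:
  assumes "l4\<^sup>2 + l5\<^sup>2 \<le> 1" and "(lam4 l2 l4 s)\<^sup>2 + (lam5 l1 l5 s)\<^sup>2 \<le> 1"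
  shows "(lam1 l1 l5 s)\<^sup>2 + (lam2 l2 l4 s)\<^sup>2 + (lam3 l1 l2 l4 l5 s)\<^sup>2
       = l1\<^sup>2 + l2\<^sup>2 + (lam3 l1 l2 l4 l5 0)\<^sup>2"
  using lam1_lam5_invariant [of l1 l5 s] lam2_lam4_invariant [of l2 l4 s]
    lam3_sq [OF assms(2)] lam3_sq [of l2 l4 0 l1 l5] assms(1) by simp

section \<open>Conservation of momentum along a geodesic\<close>

locale geodesic =
  fixes l1 l2 l4 l5 L :: real and x :: "real \<Rightarrow> real^3" and R :: "real \<Rightarrow> real^3^3"
  assumes geo: "sr_geodesic l1 l2 l4 l5 L x R"
begin

abbreviation m1 where "m1 \<equiv> lam1 l1 l5"
abbreviation m2 where "m2 \<equiv> lam2 l2 l4"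
abbreviation m3 where "m3 \<equiv> lam3 l1 l2 l4 l5"
abbreviation m4 where "m4 \<equiv> lam4 l2 l4"
abbreviation m5 where "m5 \<equiv> lam5 l1 l5"

lemma radicand_bound: "s \<in> {0..L} \<Longrightarrow> (m4 s)\<^sup>2 + (m5 s)\<^sup>2 \<le> 1"
  and initial: "x 0 = 0" "R 0 = mat 1"
  using geo by (auto simp: sr_geodesic_def)

lemma m3_nonneg: "s \<in> {0..L} \<Longrightarrow> m3 s \<ge> 0"
  using radicand_bound [of s] by (simp add: lam3_def)

text \<open>\<open>s_max\<close> is the infimum of the positive zeros and \<open>L\<close> does not
  exceed it, so no zero lies strictly between 0 and \<open>L\<close>.\<close>

lemma m3_pos:
  assumes "0 < s" "s < L"
  shows "m3 s > 0"
proof -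
  have "m3 s \<noteq> 0"
  proof
    assume "m3 s = 0"
    then have "s_max l1 l2 l4 l5 \<le> ereal s"
      unfolding s_max_def using assms by (intro Inf_lower) auto
    moreover have "ereal L \<le> s_max l1 l2 l4 l5" using geo by (simp add: sr_geodesic_def)
    ultimately have "ereal L \<le> ereal s" by (rule order_trans [rotated])
    then show False using assms by simp
  qed
  moreover have "m3 s \<ge> 0"
    using assms by (simp add: m3_nonneg)
  ultimately show ?thesis by simp
qed

lemma DERIV_R:
  assumes "0 < s" "s < L"
  shows "((\<lambda>s. R s $ i $ 1) has_real_derivative - m5 s * R s $ i $ 3 / m3 s) (at s)"
    and "((\<lambda>s. R s $ i $ 2) has_real_derivative m4 s * R s $ i $ 3 / m3 s) (at s)"
    and "((\<lambda>s. R s $ i $ 3) has_real_derivative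
           (m5 s * R s $ i $ 1 - m4 s * R s $ i $ 2) / m3 s) (at s)"
proof -
  have "(R has_vector_derivative (1 / m3 s) *\<^sub>R (R s ** omega_mat (m4 s) (m5 s))) (at s)"
    using geo assms by (simp add: sr_geodesic_def)
  then have "((\<lambda>s. R s $ i $ j) has_vector_derivative
      ((1 / m3 s) *\<^sub>R (R s ** omega_mat (m4 s) (m5 s))) $ i $ j) (at s)" for j
    by (intro bounded_linear.has_vector_derivative [OF bounded_linear_vec_nth])
  then have *: "((\<lambda>s. R s $ i $ j) has_real_derivative
      ((1 / m3 s) *\<^sub>R (R s ** omega_mat (m4 s) (m5 s))) $ i $ j) (at s)" for j
    by (simp add: has_real_derivative_iff_has_vector_derivative)
  show "((\<lambda>s. R s $ i $ 1) has_real_derivative - m5 s * R s $ i $ 3 / m3 s) (at s)"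
    by (rule DERIV_cong [OF * [of 1]])
      (simp add: matrix_matrix_mult_def omega_mat_def sum_3)
  show "((\<lambda>s. R s $ i $ 2) has_real_derivative m4 s * R s $ i $ 3 / m3 s) (at s)"
    by (rule DERIV_cong [OF * [of 2]])
      (simp add: matrix_matrix_mult_def omega_mat_def sum_3)
  show "((\<lambda>s. R s $ i $ 3) has_real_derivative
           (m5 s * R s $ i $ 1 - m4 s * R s $ i $ 2) / m3 s) (at s)"
    by (rule DERIV_cong [OF * [of 3]])
      (simp add: matrix_matrix_mult_def omega_mat_def sum_3 field_simps)
qed

lemma DERIV_x:
  assumes "0 < s" "s < L"
  shows "((\<lambda>s. x s $ i) has_real_derivative R s $ i $ 3) (at s)"
proof -
  have "(x has_vector_derivative R s *v e_z) (at s)"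
    using geo assms by (simp add: sr_geodesic_def)
  from bounded_linear.has_vector_derivative [OF bounded_linear_vec_nth this, of i]
  show ?thesis by (simp add: has_real_derivative_iff_has_vector_derivative mult_e_z_nth)
qed

lemma continuous_R: "continuous_on {0..L} (\<lambda>s. R s $ i $ j)"
  using geo unfolding sr_geodesic_def by (auto intro!: continuous_intros)

lemma continuous_x: "continuous_on {0..L} (\<lambda>s. x s $ i)"
  using geo unfolding sr_geodesic_def by (auto intro!: continuous_intros)

text \<open>Each coordinate has derivative 0 in the interior, where \<open>m3\<close> is positive;
  continuity of \<open>R\<close> extends the constancy to the end points, which may be
  cusps.\<close>

lemma momentum_conserved:
  assumes "s \<in> {0..L}"
  shows "R s *v momentum l1 l2 l4 l5 s = momentum l1 l2 l4 l5 0"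
proof (cases "L = 0")
  case True
  then show ?thesis using geo assms by (simp add: sr_geodesic_def)
next
  case False
  then have "0 < L" using geo by (simp add: sr_geodesic_def)
  define f where "f i s = R s $ i $ 1 * m1 s + R s $ i $ 2 * m2 s + R s $ i $ 3 * m3 s" for i s
  have f: "f i s = (R s *v momentum l1 l2 l4 l5 s) $ i" for i s
    by (simp add: f_def matrix_vector_mult_def sum_3)
  have "f i s = f i 0" for i
  proof (rule DERIV_isconst2 [OF \<open>0 < L\<close>])
    show "continuous_on {0..L} (f i)"
      unfolding f_def by (intro continuous_intros continuous_R continuous_on_lam)
    fix t assume t: "0 < t" "t < L"
    note pos = m3_pos [OF t]
    show "(f i has_real_derivative 0) (at t)"
      unfolding f_def
      by (rule derivative_eq_intros DERIV_R t DERIV_lam1 DERIV_lam2 DERIV_lam3 pos refl)+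
        (use pos in \<open>simp add: field_simps\<close>)
  qed (use assms in auto)
  moreover have "R 0 = mat 1" using geo by (simp add: sr_geodesic_def)
  ultimately show ?thesis by (simp add: vec_eq_iff f)
qed

lemma inner_momentum:
  assumes "s \<in> {0..L}"
  shows "momentum l1 l2 l4 l5 0 \<bullet> (R s *v e_z) = m3 s"
proof -
  have "orthogonal_matrix (R s)" using geo assms by (simp add: sr_geodesic_def)
  then have "(R s *v momentum l1 l2 l4 l5 s) \<bullet> (R s *v e_z) = m3 s"
    by (simp add: orthogonal_matrix_inner inner_e_z)
  then show ?thesis by (simp only: momentum_conserved [OF assms])
qed

end

section \<open>Consequences of the reversed tangent\<close>

locale reversing_geodesic = geodesic +
  assumes reverse: "R L *v e_z = - e_z"
begin

lemma L_pos: "0 < L"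
proof (rule ccontr)
  assume "\<not> 0 < L"
  then have "L = 0" using geo by (simp add: sr_geodesic_def)
  have "(R L *v e_z) $ 3 = (- e_z) $ 3" by (simp only: reverse)
  with \<open>L = 0\<close> show False by (simp add: initial)
qed

lemma m3_ends: "m3 0 = 0" "m3 L = 0"
proof -
  have "m3 L = - m3 0"
    using inner_momentum [of L] L_pos by (simp add: reverse inner_e_z)
  moreover have "m3 0 \<ge> 0" "m3 L \<ge> 0" using m3_nonneg L_pos by auto
  ultimately show "m3 0 = 0" "m3 L = 0" by simp_all
qed

lemma s_max_eq: "s_max l1 l2 l4 l5 = ereal L"
proof (rule antisym)
  show "s_max l1 l2 l4 l5 \<le> ereal L"
    unfolding s_max_def using L_pos m3_ends by (intro Inf_lower) auto
  show "ereal L \<le> s_max l1 l2 l4 l5" using geo by (simp add: sr_geodesic_def)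
qed

lemma end_point_nonzero: "x L \<noteq> 0"
proof
  assume "x L = 0"
  define f where "f s = momentum l1 l2 l4 l5 0 \<bullet> x s" for s
  have "f 0 < f L"
  proof (rule DERIV_pos_imp_increasing_open [OF L_pos])
    fix s assume s: "0 < s" "s < L"
    have "(x has_vector_derivative R s *v e_z) (at s)"
      using geo s by (simp add: sr_geodesic_def)
    then have "(f has_vector_derivative m3 s) (at s)"
      unfolding f_def using inner_momentum [of s] s
      by (metis bounded_linear.has_vector_derivative [OF bounded_linear_inner_right]
        atLeastAtMost_iff less_imp_le)
    then show "\<exists>y. (f has_real_derivative y) (at s) \<and> 0 < y"
      using m3_pos [OF s] by (auto simp: has_real_derivative_iff_has_vector_derivative)
  next
    show "continuous_on {0..L} f"
      unfolding f_def using geo by (auto simp: sr_geodesic_def intro!: continuous_intros)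
  qed
  moreover have "x 0 = 0" using geo by (simp add: sr_geodesic_def)
  ultimately show False using \<open>x L = 0\<close> by (simp add: f_def)
qed

text \<open>
  The conserved angular momentum \<open>x \<times> p + R (m4, m5, 0)\<close>, paired with \<open>e_z \<times> p\<close>,
  where \<open>p\<close> is the (horizontal) conserved linear momentum.
\<close>

lemma end_point_horizontal: "x L \<bullet> e_z = 0"
proof -
  define P where "P = l1\<^sup>2 + l2\<^sup>2"
  have le: "l4\<^sup>2 + l5\<^sup>2 \<le> 1" and le': "\<And>s. s \<in> {0..L} \<Longrightarrow> (m4 s)\<^sup>2 + (m5 s)\<^sup>2 \<le> 1"
    using geo by (auto simp: sr_geodesic_def)
  have P: "(m1 s)\<^sup>2 + (m2 s)\<^sup>2 + (m3 s)\<^sup>2 = P" if "s \<in> {0..L}" for s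
    using norm_momentum [OF le le' [OF that]] by (simp add: P_def m3_ends)
  \<comment> \<open>The initial momentum is nonzero, and its third component vanishes at the initial
    cusp.\<close>
  have Pnz: "P \<noteq> 0" using geo m3_ends by (auto simp: sr_geodesic_def P_def sum_power2_eq_zero_iff)
  \<comment> \<open>Since \<open>p \<bullet> e_z = 0\<close>, the term \<open>x s $ 3 * P\<close> is
    \<open>(x \<times> p) \<bullet> (e_z \<times> p)\<close>. In the other terms \<open>e_z\<close>
    and \<open>p\<close> appear in the moving frame, as row 3 of \<open>R s\<close> and as the
    momentum functions.\<close>
  define q where "q s = x s $ 3 * P
    + m4 s * (R s $ 3 $ 2 * m3 s - R s $ 3 $ 3 * m2 s)
    + m5 s * (R s $ 3 $ 3 * m1 s - R s $ 3 $ 1 * m3 s)" for s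
  have "q L = q 0"
  proof (rule DERIV_isconst2 [OF L_pos])
    show "continuous_on {0..L} q"
      unfolding q_def by (intro continuous_intros continuous_R continuous_x continuous_on_lam)
    fix s assume s: "0 < s" "s < L"
    then have s': "s \<in> {0..L}" by simp
    note pos = m3_pos [OF s]
    have "(R s *v momentum l1 l2 l4 l5 s) $ 3 = 0"
      by (simp add: momentum_conserved [OF s'] m3_ends)
    then have orth: "R s $ 3 $ 1 * m1 s + R s $ 3 $ 2 * m2 s + R s $ 3 $ 3 * m3 s = 0"
      by (simp add: matrix_vector_mult_def sum_3)
    show "(q has_real_derivative 0) (at s)"
      unfolding q_def
      by (rule derivative_eq_intros DERIV_R DERIV_x s DERIV_lam1 DERIV_lam2 DERIV_lam3
          DERIV_lam4 DERIV_lam5 pos refl)+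
        (use pos orth P [OF s', symmetric] in \<open>simp add: field_simps\<close>, algebra)
  qed (use L_pos in auto)
  have R0: "R 0 = mat 1" "x 0 = 0" using geo by (simp_all add: sr_geodesic_def)
  have "R L $ 3 $ 3 = -1" using arg_cong [OF reverse, of "\<lambda>v. v $ 3"] by (simp add: mult_e_z_nth)
  \<comment> \<open>At both ends \<open>m3\<close> vanishes, while \<open>R s $ 3 $ 3\<close> is 1
    at 0 and -1 at \<open>L\<close>; this causes the sign on the right. \<open>cusp_symmetry\<close>
    then leaves \<open>x L $ 3 * P = 0\<close>.\<close>
  with \<open>q L = q 0\<close> have "x L $ 3 * P + (m4 L * m2 L - m5 L * m1 L) = - (l4 * l2 - l5 * l1)"
    by (simp add: q_def m3_ends R0 mat_def algebra_simps)
  moreover have "m4 L * m2 L - m5 L * m1 L = - (l4 * l2 - l5 * l1)"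
    using lam3_sq [OF le' [of L]] lam3_sq [OF le' [of 0]] m3_ends L_pos
    by (intro cusp_symmetry) auto
  ultimately show ?thesis using Pnz by (simp add: inner_e_z)
qed

end

subsection \<open>The calibration\<close>

text \<open>The fundamental theorem yields the gauge integral of \<open>W'\<close>; the comparison
  is made there, and only the continuous \<open>f\<close> passes to the Lebesgue integral.\<close>

lemma ennreal_increment_le_nn_integral_Icc:
  fixes W W' f :: "real \<Rightarrow> real"
  assumes "a \<le> b"
    and W: "\<And>s. s \<in> {a..b} \<Longrightarrow> (W has_real_derivative W' s) (at s within {a..b})"
    and f: "continuous_on {a..b} f" "\<And>s. s \<in> {a..b} \<Longrightarrow> 0 \<le> f s"
    and le: "\<And>s. s \<in> {a..b} \<Longrightarrow> W' s \<le> f s"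
  shows "ennreal (W b - W a) \<le> (\<integral>\<^sup>+ s\<in>{a..b}. ennreal (f s) \<partial>lborel)"
proof -
  have I: "(f has_integral integral {a..b} f) {a..b}"
    by (intro integrable_integral integrable_continuous_real f)
  have "(W' has_integral (W b - W a)) {a..b}"
    using W by (intro fundamental_theorem_of_calculus \<open>a \<le> b\<close>)
      (simp add: has_real_derivative_iff_has_vector_derivative)
  then have "W b - W a \<le> integral {a..b} f"
    by (rule has_integral_le [OF _ I]) (rule le)
  then have "ennreal (W b - W a) \<le> ennreal (integral {a..b} f)" by (rule ennreal_leI)
  also have "\<dots> = (\<integral>\<^sup>+ s\<in>{a..b}. ennreal (f s) \<partial>lborel)"
    using f(2) by (intro nn_integral_has_integral_lebesgue' [OF _ I, symmetric])
  finally show ?thesis .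
qed

text \<open>Made for cusps, where \<open>f\<close> may blow up at the ends: the closed case is
  applied to intervals exhausting \<open>{a<..<b}\<close>, and continuity of \<open>W\<close> gives
  the limit.\<close>

lemma ennreal_increment_le_nn_integral_Ioo:
  fixes W W' f :: "real \<Rightarrow> real"
  assumes "a < b" and cont: "continuous_on {a..b} W"
    and W: "\<And>s. s \<in> {a<..<b} \<Longrightarrow> (W has_real_derivative W' s) (at s)"
    and f: "continuous_on {a<..<b} f" "\<And>s. s \<in> {a<..<b} \<Longrightarrow> 0 \<le> f s"
    and le: "\<And>s. s \<in> {a<..<b} \<Longrightarrow> W' s \<le> f s"
  shows "ennreal (W b - W a) \<le> (\<integral>\<^sup>+ s\<in>{a<..<b}. ennreal (f s) \<partial>lborel)"
    (is "_ \<le> ?I")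
proof -
  \<comment> \<open>The shift by 2 gives \<open>d k \<le> (b - a) / 2\<close>, so the shrunken
    intervals are never reversed.\<close>
  define d where "d k = (b - a) / real (k + 2)" for k
  have "0 < d k" for k using \<open>a < b\<close> by (simp add: d_def)
  moreover have "d k \<le> (b - a) / 2" for k
    unfolding d_def using \<open>a < b\<close> by (intro divide_left_mono) auto
  ultimately have d: "0 < d k" "d k \<le> (b - a) / 2" for k by blast+
  have mem: "a + d k \<in> {a..b}" "b - d k \<in> {a..b}" for k
    using d [of k] \<open>a < b\<close> by auto
  have le_I: "ennreal (W (b - d k) - W (a + d k)) \<le> ?I" for k
  proof -
    have sub: "{a + d k..b - d k} \<subseteq> {a<..<b}" using d(1) [of k] by auto
    have "ennreal (W (b - d k) - W (a + d k)) \<le> (\<integral>\<^sup>+ s\<in>{a + d k..b - d k}. ennreal (f s) \<partial>lborel)"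
    proof (rule ennreal_increment_le_nn_integral_Icc)
      show "a + d k \<le> b - d k" using d(2) [of k] by simp
      show "continuous_on {a + d k..b - d k} f" using f(1) sub by (rule continuous_on_subset)
    qed (use sub f(2) le in \<open>auto intro!: has_field_derivative_at_within [OF W]\<close>)
    also have "\<dots> \<le> ?I"
      using sub by (intro nn_integral_mono) (auto simp: indicator_def)
    finally show ?thesis .
  qed
  have "(\<lambda>k. (b - a) / real (k + 2)) \<longlonglongrightarrow> 0" by real_asymp
  then have lim: "d \<longlonglongrightarrow> 0" by (simp add: d_def [abs_def])
  have "(\<lambda>k. W (b - d k)) \<longlonglongrightarrow> W b"
  proof (rule continuous_on_tendsto_compose [OF cont])
    show "(\<lambda>k. b - d k) \<longlonglongrightarrow> b" using tendsto_diff [OF tendsto_const lim, of b] by simp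
    show "\<forall>\<^sub>F k in sequentially. b - d k \<in> {a..b}"
      using mem by (intro always_eventually) blast
  qed (use \<open>a < b\<close> in auto)
  moreover have "(\<lambda>k. W (a + d k)) \<longlonglongrightarrow> W a"
  proof (rule continuous_on_tendsto_compose [OF cont])
    show "(\<lambda>k. a + d k) \<longlonglongrightarrow> a" using tendsto_add [OF tendsto_const lim, of a] by simp
    show "\<forall>\<^sub>F k in sequentially. a + d k \<in> {a..b}"
      using mem by (intro always_eventually) blast
  qed (use \<open>a < b\<close> in auto)
  ultimately have "(\<lambda>k. ennreal (W (b - d k) - W (a + d k))) \<longlonglongrightarrow> ennreal (W b - W a)"
    by (intro tendsto_ennrealI tendsto_diff)
  then show ?thesis
    by (rule LIMSEQ_le_const2) (intro exI allI impI le_I)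
qed

section \<open>The pointwise calibration inequality\<close>

text \<open>The regularized \<open>\<Gamma>'\<close>. For \<open>\<epsilon> > 0\<close> the absolute
  value keeps the denominator positive on the whole line, so that antiderivatives exist beyond
  \<open>{-1..1}\<close>.\<close>

definition slope :: "real \<Rightarrow> real \<Rightarrow> real \<Rightarrow> real" where
  "slope a \<epsilon> w = sqrt (1 - a\<^sup>2 * (1 - w\<^sup>2)) / sqrt (\<bar>1 - w\<^sup>2\<bar> + \<epsilon>)"

lemma continuous_on_slope:
  assumes "\<epsilon> > 0"
  shows "continuous_on S (slope a \<epsilon>)"
proof -
  have "\<bar>1 - w\<^sup>2\<bar> + \<epsilon> \<noteq> 0" for w :: real using assms by (smt (verit))
  then show ?thesis unfolding slope_def [abs_def] by (intro continuous_intros) auto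
qed

text \<open>Integrating over the larger interval \<open>{-2..2}\<close> gives two-sided derivatives
  also at the poles -1 and 1, which the tangent of a competitor may meet at interior times.\<close>

lemma slope_antiderivative:
  assumes "\<epsilon> > 0"
  obtains \<Gamma> where "\<And>w. w \<in> {-1..1} \<Longrightarrow> (\<Gamma> has_real_derivative slope a \<epsilon> w) (at w)"
proof -
  obtain \<Gamma>
    where \<Gamma>: "\<And>w. w \<in> {-2..2} \<Longrightarrow> (\<Gamma> has_vector_derivative slope a \<epsilon> w) (at w within {-2..2})"
    using antiderivative_continuous [OF continuous_on_slope [OF assms], of "-2" 2 a] by blast
  have "(\<Gamma> has_real_derivative slope a \<epsilon> w) (at w)" if "w \<in> {-1..1}" for w
  proof -
    have "at w within {-2..2} = at w" using that by (intro at_within_interior) auto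
    then show ?thesis
      using \<Gamma> [of w] that by (simp add: has_real_derivative_iff_has_vector_derivative)
  qed
  then show thesis by (rule that)
qed

text \<open>Bessel's inequality: the residual \<open>r\<close> has nonnegative square.\<close>

lemma inner_orthonormal_pair_le:
  fixes e f n :: "'a::real_inner"
  assumes "norm e = 1" "norm f = 1" "e \<bullet> f = 0"
  shows "(n \<bullet> e)\<^sup>2 + (n \<bullet> f)\<^sup>2 \<le> (norm n)\<^sup>2"
proof -
  have ee: "e \<bullet> e = 1" "f \<bullet> f = 1" "f \<bullet> e = 0"
    using assms by (simp_all add: norm_eq_1 inner_commute)
  define r where "r = n - (n \<bullet> e) *\<^sub>R e - (n \<bullet> f) *\<^sub>R f"
  have "r \<bullet> r = (norm n)\<^sup>2 - (n \<bullet> e)\<^sup>2 - (n \<bullet> f)\<^sup>2"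
    by (simp add: r_def inner_diff_left inner_diff_right ee assms(3) inner_commute [of e n]
      inner_commute [of f n] power2_norm_eq_inner) (simp add: power2_eq_square)
  then show ?thesis using inner_ge_zero [of r] by simp
qed

text \<open>As \<open>N\<close> is orthogonal to \<open>n\<close>, only the part of \<open>f\<close>
  orthogonal to \<open>n\<close> contributes; its length is
  \<open>sqrt (1 - (n \<bullet> f)\<^sup>2)\<close>.\<close>

lemma inner_tangent_le:
  fixes f n N :: "'a::real_inner"
  assumes "norm n = 1" "norm f = 1" "n \<bullet> N = 0"
  shows "\<bar>N \<bullet> f\<bar> \<le> norm N * sqrt (1 - (n \<bullet> f)\<^sup>2)"
proof -
  have nn: "n \<bullet> n = 1" "f \<bullet> f = 1" using assms by (simp_all add: norm_eq_1)
  have "N \<bullet> f = N \<bullet> (f - (n \<bullet> f) *\<^sub>R n)"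
    using assms by (simp add: inner_diff_right inner_commute)
  also have "\<bar>\<dots>\<bar> \<le> norm N * norm (f - (n \<bullet> f) *\<^sub>R n)"
    by (rule Cauchy_Schwarz_ineq2)
  also have "norm (f - (n \<bullet> f) *\<^sub>R n) = sqrt (1 - (n \<bullet> f)\<^sup>2)"
    by (simp add: norm_eq_sqrt_inner inner_diff_left inner_diff_right nn inner_commute power2_eq_square)
  finally show ?thesis .
qed

text \<open>
  With \<open>p = a sqrt (1 - w\<^sup>2)\<close> and \<open>q = sqrt (1 - p\<^sup>2)\<close> this is the Cauchy--Schwarz inequality
  \<open>p * 1 + q * \<kappa> \<le> sqrt (1 + \<kappa>\<^sup>2)\<close>.
\<close>

lemma calibration_inequality:
  fixes e f n N :: "'a::real_inner"
  assumes "norm e = 1" "norm f = 1" "e \<bullet> f = 0" "norm n = 1" "n \<bullet> N = 0"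
    and a: "0 \<le> a" "a \<le> 1" and "\<epsilon> > 0"
  shows "a * (n \<bullet> e) - slope a \<epsilon> (n \<bullet> f) * (N \<bullet> f) \<le> sqrt (1 + (norm N)\<^sup>2)"
proof -
  define w where "w = n \<bullet> f"
  have ew: "(n \<bullet> e)\<^sup>2 \<le> 1 - w\<^sup>2"
    using inner_orthonormal_pair_le [of e f n] assms by (simp add: w_def)
  then have w: "0 \<le> 1 - w\<^sup>2" by (smt (verit) zero_le_power2)
  define p where "p = a * sqrt (1 - w\<^sup>2)"
  define q where "q = sqrt (1 - a\<^sup>2 * (1 - w\<^sup>2))"
  have "a\<^sup>2 * (1 - w\<^sup>2) \<le> 1 * 1"
    using a w by (intro mult_mono) (auto simp: power_le_one)
  then have q0: "0 \<le> q" and q2: "q\<^sup>2 = 1 - a\<^sup>2 * (1 - w\<^sup>2)" by (simp_all add: q_def)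
  have p2: "p\<^sup>2 = a\<^sup>2 * (1 - w\<^sup>2)" using w by (simp add: p_def power_mult_distrib)
  have "\<bar>n \<bullet> e\<bar> \<le> sqrt (1 - w\<^sup>2)" using ew by (simp add: real_le_rsqrt)
  then have 1: "a * (n \<bullet> e) \<le> p"
    unfolding p_def using a by (intro mult_left_mono) auto
  have s0: "0 \<le> slope a \<epsilon> w"
    using q0 \<open>\<epsilon> > 0\<close> by (simp add: slope_def q_def)
  have "- (slope a \<epsilon> w * (N \<bullet> f)) \<le> slope a \<epsilon> w * \<bar>N \<bullet> f\<bar>"
    using mult_left_mono [OF abs_ge_minus_self s0, of "N \<bullet> f"] by simp
  also have "\<dots> \<le> slope a \<epsilon> w * (norm N * sqrt (1 - w\<^sup>2))"
    unfolding w_def [symmetric] using inner_tangent_le [of n f N] assms s0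
    by (intro mult_left_mono) (simp_all add: w_def)
  also have "\<dots> = q * norm N * (sqrt (1 - w\<^sup>2) / sqrt (1 - w\<^sup>2 + \<epsilon>))"
    using w by (simp add: slope_def q_def)
  \<comment> \<open>The regularization can only shrink this factor, so the inequality survives for
    every \<open>\<epsilon> > 0\<close>.\<close>
  also have "\<dots> \<le> q * norm N * 1"
    using q0 w \<open>\<epsilon> > 0\<close> by (intro mult_left_mono) (auto simp: divide_le_eq_1)
  finally have 2: "- (slope a \<epsilon> w * (N \<bullet> f)) \<le> q * norm N" by simp
  \<comment> \<open>Lagrange's identity for the vectors \<open>(p, q)\<close> and
    \<open>(1, norm N)\<close>, the first of unit length.\<close>
  have "(p + q * norm N)\<^sup>2 = (p\<^sup>2 + q\<^sup>2) * (1 + (norm N)\<^sup>2) - (p * norm N - q)\<^sup>2" by algebra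
  also have "\<dots> \<le> 1 + (norm N)\<^sup>2" by (simp add: p2 q2)
  finally have "p + q * norm N \<le> sqrt (1 + (norm N)\<^sup>2)" by (rule real_le_rsqrt)
  with 1 2 show ?thesis by (simp add: w_def)
qed

section \<open>The lower bound for an arbitrary competitor\<close>

lemma smooth_on_openD:
  assumes "smooth_on_open f S"
  shows "((\<lambda>g t. vector_derivative g (at t)) ^^ k) f differentiable_on S"
  using assms by (simp add: smooth_on_open_def)

text \<open>The derivative of \<open>a * (x \<bullet> e) - \<Gamma> (n \<bullet> e_z)\<close> is
  bounded by the cost density, and its increment along the curve depends on the end conditions
  alone.\<close>

lemma P_curve_cost_lower_bound:
  assumes adm: "P_curve_admissible x1 (- e_z) L x n"
    and e: "norm e = 1" "e \<bullet> e_z = 0"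
    and a: "0 \<le> a" "a \<le> 1" and "\<epsilon> > 0"
    and \<Gamma>: "\<And>w. w \<in> {-1..1} \<Longrightarrow> (\<Gamma> has_real_derivative slope a \<epsilon> w) (at w)"
  shows "ennreal (a * (x1 \<bullet> e) + \<Gamma> 1 - \<Gamma> (-1)) \<le> P_curve_cost L x"
proof -
  have x: "(x has_vector_derivative n s) (at s within {0..L})" if "s \<in> {0..L}" for s
    using adm that by (simp add: P_curve_admissible_def)
  have norm_n: "norm (n s) = 1" if "s \<in> {0..L}" for s
    using adm that by (simp add: P_curve_admissible_def)
  have smooth: "smooth_on_open x {0<..<L}" and n_cont: "continuous_on {0..L} n"
    using adm by (simp_all add: P_curve_admissible_def)
  have ends: "x 0 = 0" "n 0 = e_z" "x L = x1" "n L = - e_z" "0 \<le> L"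
    using adm by (simp_all add: P_curve_admissible_def)
  have ez: "norm e_z = 1" "e_z \<bullet> e_z = 1" by (simp_all add: e_z_def norm_axis_1 inner_axis)
  have "L \<noteq> 0"
  proof
    assume "L = 0"
    have "n L \<bullet> e_z = - 1" by (simp add: ends ez)
    then show False using \<open>L = 0\<close> by (simp add: ends ez)
  qed
  with ends have "0 < L" by simp
  define N where "N s = vector_derivative (\<lambda>t. vector_derivative x (at t)) (at s)" for s
  have x': "(x has_vector_derivative n s) (at s)" if "s \<in> {0<..<L}" for s
  proof -
    have "at s within {0..L} = at s" using that by (intro at_within_interior) auto
    then show ?thesis using x [of s] that by simp
  qed
  \<comment> \<open>\<open>N\<close> is built from the vector derivative of \<open>x\<close>, which
    is known to agree with \<open>n\<close> in the open interval.\<close>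
  have n': "(n has_vector_derivative N s) (at s)" if "s \<in> {0<..<L}" for s
  proof -
    have "(\<lambda>t. vector_derivative x (at t)) differentiable at s"
      using smooth_on_openD [OF smooth, of 1] that
      by (simp add: differentiable_on_eq_differentiable_at)
    then have "((\<lambda>t. vector_derivative x (at t)) has_vector_derivative N s) (at s)"
      unfolding N_def by (rule vector_derivative_works [THEN iffD1])
    then show ?thesis
      by (rule has_vector_derivative_transform_within_open [OF _ open_greaterThanLessThan that])
        (simp add: vector_derivative_at [OF x'])
  qed
  \<comment> \<open>\<open>N\<close> is the second iterated derivative of \<open>x\<close>;
    smoothness makes it differentiable and hence continuous.\<close>
  have N_cont: "continuous_on {0<..<L} N"
    using differentiable_imp_continuous_on [OF smooth_on_openD [OF smooth, of 2]]
    by (simp add: numeral_2_eq_2 N_def [abs_def])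
  have nN: "n s \<bullet> N s = 0" if "s \<in> {0<..<L}" for s
  proof -
    have "((\<lambda>s. n s \<bullet> n s) has_real_derivative 2 * (n s \<bullet> N s)) (at s)"
      using bounded_bilinear.has_vector_derivative [OF bounded_bilinear_inner n' [OF that] n' [OF that]]
      by (simp add: has_real_derivative_iff_has_vector_derivative inner_commute)
    moreover have "((\<lambda>s. n s \<bullet> n s) has_real_derivative 0) (at s)"
    proof (rule has_field_derivative_transform_within_open [OF DERIV_const open_greaterThanLessThan that])
      show "\<And>t. t \<in> {0<..<L} \<Longrightarrow> 1 = n t \<bullet> n t" using norm_n by (auto simp: norm_eq_1)
    qed
    ultimately show ?thesis using DERIV_unique by fastforce
  qed
  have nz: "n s \<bullet> e_z \<in> {-1..1}" if "s \<in> {0..L}" for s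
    using Cauchy_Schwarz_ineq2 [of "n s" e_z] norm_n [OF that] ez by (simp add: abs_le_iff)
  define W where "W s = a * (x s \<bullet> e) - \<Gamma> (n s \<bullet> e_z)" for s
  have "ennreal (W L - W 0) \<le> (\<integral>\<^sup>+ s\<in>{0<..<L}. ennreal (sqrt (1 + (curvature x s)\<^sup>2)) \<partial>lborel)"
  proof (rule ennreal_increment_le_nn_integral_Ioo [OF \<open>0 < L\<close>])
    have "continuous_on {-1..1} \<Gamma>"
      using \<Gamma> by (meson DERIV_isCont continuous_at_imp_continuous_on)
    moreover have "continuous_on {0..L} (\<lambda>s. n s \<bullet> e_z)" by (intro continuous_intros n_cont)
    ultimately have "continuous_on {0..L} (\<lambda>s. \<Gamma> (n s \<bullet> e_z))"
      by (rule continuous_on_compose2) (use nz in blast)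
    moreover have "continuous_on {0..L} x"
      using x by (meson has_vector_derivative_continuous continuous_on_eq_continuous_within)
    ultimately show "continuous_on {0..L} W"
      unfolding W_def by (intro continuous_intros)
    show "continuous_on {0<..<L} (\<lambda>s. sqrt (1 + (curvature x s)\<^sup>2))"
      using N_cont unfolding curvature_def N_def [symmetric] by (intro continuous_intros)
    fix s assume s: "s \<in> {0<..<L}"
    then have s': "s \<in> {0..L}" by simp
    have "((\<lambda>s. x s \<bullet> e) has_real_derivative n s \<bullet> e) (at s)"
      using bounded_linear.has_vector_derivative [OF bounded_linear_inner_left x' [OF s]]
      by (simp add: has_real_derivative_iff_has_vector_derivative)
    moreover have "((\<lambda>s. n s \<bullet> e_z) has_real_derivative N s \<bullet> e_z) (at s)"
      using bounded_linear.has_vector_derivative [OF bounded_linear_inner_left n' [OF s]]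
      by (simp add: has_real_derivative_iff_has_vector_derivative)
    then have "((\<lambda>s. \<Gamma> (n s \<bullet> e_z)) has_real_derivative slope a \<epsilon> (n s \<bullet> e_z) * (N s \<bullet> e_z)) (at s)"
      by (rule DERIV_chain2 [where f = \<Gamma> and g = "\<lambda>s. n s \<bullet> e_z", OF \<Gamma> [OF nz [OF s']]])
    ultimately show "(W has_real_derivative
        a * (n s \<bullet> e) - slope a \<epsilon> (n s \<bullet> e_z) * (N s \<bullet> e_z)) (at s)"
      unfolding W_def by (intro DERIV_diff DERIV_cmult)
    show "a * (n s \<bullet> e) - slope a \<epsilon> (n s \<bullet> e_z) * (N s \<bullet> e_z) \<le> sqrt (1 + (curvature x s)\<^sup>2)"
      unfolding curvature_def N_def [symmetric]
      by (intro calibration_inequality e a ez nN s norm_n s' \<open>\<epsilon> > 0\<close>)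
  qed simp
  then show ?thesis by (simp add: P_curve_cost_def W_def ends ez algebra_simps)
qed

subsection \<open>The optimal curve\<close>

text \<open>The vertical component: the solution of \<open>u'' = u\<close> with value 1 at 0 and -1
  at \<open>2 * h\<close>.\<close>

definition cos_angle :: "real \<Rightarrow> real \<Rightarrow> real" where
  "cos_angle h s = sinh (h - s) / sinh h"

definition sin_angle :: "real \<Rightarrow> real \<Rightarrow> real" where
  "sin_angle h s = sqrt (1 - (cos_angle h s)\<^sup>2)"

definition reach :: "real \<Rightarrow> real" where
  "reach h = integral {0..2 * h} (sin_angle h)"

lemma continuous_on_sin_angle: "h \<noteq> 0 \<Longrightarrow> continuous_on S (sin_angle h)"
  unfolding sin_angle_def [abs_def] cos_angle_def by (intro continuous_intros) auto

lemma continuous_on_cos_angle: "h \<noteq> 0 \<Longrightarrow> continuous_on S (cos_angle h)"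
  unfolding cos_angle_def [abs_def] by (intro continuous_intros) auto

lemma abs_sinh_less_iff: "\<bar>sinh t\<bar> < sinh h \<longleftrightarrow> \<bar>t\<bar> < (h::real)"
  by (simp flip: sinh_real_abs)

lemma abs_sinh_le_iff: "\<bar>sinh t\<bar> \<le> sinh h \<longleftrightarrow> \<bar>t\<bar> \<le> (h::real)"
  by (simp flip: sinh_real_abs)

lemma abs_cos_angle_less:
  assumes "0 < s" "s < 2 * h"
  shows "\<bar>cos_angle h s\<bar> < 1"
proof -
  have "\<bar>sinh (h - s)\<bar> < sinh h" using assms by (auto simp: abs_sinh_less_iff)
  then show ?thesis using assms by (simp add: cos_angle_def abs_divide)
qed

lemma cos_angle_ends:
  assumes "h \<noteq> 0"
  shows "cos_angle h 0 = 1" "cos_angle h (2 * h) = -1"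
proof -
  have "h - 2 * h = - h" by simp
  then show "cos_angle h (2 * h) = -1" unfolding cos_angle_def using assms by (simp del: minus_diff_eq)
qed (use assms in \<open>simp add: cos_angle_def\<close>)

lemma cos_angle_sq_le:
  assumes "0 < h" "s \<in> {0..2 * h}"
  shows "(cos_angle h s)\<^sup>2 \<le> 1"
proof (cases "0 < s \<and> s < 2 * h")
  case True
  then show ?thesis using abs_cos_angle_less [of s h] by (simp add: abs_square_le_1)
next
  case False
  then have "s = 0 \<or> s = 2 * h" using assms by auto
  then show ?thesis using cos_angle_ends [of h] assms(1) by auto
qed

lemma sin_angle_sq: "0 < h \<Longrightarrow> s \<in> {0..2 * h} \<Longrightarrow> (sin_angle h s)\<^sup>2 = 1 - (cos_angle h s)\<^sup>2"
  by (simp add: sin_angle_def cos_angle_sq_le)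

lemma sin_angle_pos: "0 < s \<Longrightarrow> s < 2 * h \<Longrightarrow> 0 < sin_angle h s"
  using abs_cos_angle_less [of s h] by (simp add: sin_angle_def abs_square_less_1)

lemma sin_angle_nonneg: "0 < h \<Longrightarrow> s \<in> {0..2 * h} \<Longrightarrow> 0 \<le> sin_angle h s"
  by (simp add: sin_angle_def cos_angle_sq_le)

section \<open>The horizontal distance that is covered\<close>

lemma reach_le:
  assumes "0 < h"
  shows "reach h \<le> 2 * h"
proof -
  have "reach h \<le> integral {0..2 * h} (\<lambda>_. 1)"
    unfolding reach_def using assms
    by (intro integral_le integrable_continuous_real continuous_on_sin_angle continuous_on_const)
      (auto simp: sin_angle_def)
  then show ?thesis using assms by simp
qed

text \<open>On the middle half, of length \<open>h\<close>, the estimate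
  \<open>sinh h \<ge> 2 * sinh (h / 2)\<close> bounds the cosine by \<open>1 / 2\<close> in absolute
  value, so the sine is at least \<open>1 / 2\<close> there.\<close>

lemma reach_ge:
  assumes "0 < h"
  shows "h / 2 \<le> reach h"
proof -
  have ge: "1 / 2 \<le> sin_angle h s" if "s \<in> {h / 2..3 * h / 2}" for s
  proof -
    have "\<bar>h - s\<bar> \<le> h / 2"
      using that unfolding abs_le_iff atLeastAtMost_iff by linarith
    then have "\<bar>sinh (h - s)\<bar> \<le> sinh (h / 2)" by (simp only: abs_sinh_le_iff)
    moreover have "sinh h = 2 * sinh (h / 2) * cosh (h / 2)"
      using sinh_double [of "h / 2"] by simp
    moreover have "sinh (h / 2) * 1 \<le> sinh (h / 2) * cosh (h / 2)"
      using assms cosh_real_ge_1 by (intro mult_left_mono) auto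
    ultimately have "2 * \<bar>sinh (h - s)\<bar> \<le> sinh h" by linarith
    then have "\<bar>cos_angle h s\<bar> \<le> \<bar>1 / 2\<bar>" using assms by (simp add: cos_angle_def field_simps)
    then have "(cos_angle h s)\<^sup>2 \<le> (1 / 2)\<^sup>2" by (simp only: abs_le_square_iff)
    then show ?thesis
      unfolding sin_angle_def by (intro real_le_rsqrt) (simp add: power2_eq_square)
  qed
  have int: "sin_angle h integrable_on {a..b}" for a b
    using assms by (intro integrable_continuous_real continuous_on_sin_angle) auto
  have "h / 2 = integral {h / 2..3 * h / 2} (\<lambda>_. 1 / 2)" using assms by simp
  also have "\<dots> \<le> integral {h / 2..3 * h / 2} (sin_angle h)"
    by (rule integral_le) (use int ge in auto)
  also have "\<dots> \<le> reach h"
    unfolding reach_def using assms sin_angle_nonneg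
    by (intro integral_subset_le int ballI) auto
  finally show ?thesis .
qed

text \<open>Moves the dependence on \<open>h\<close> into the integrand, so that continuity of
  parameter integrals over a fixed domain applies.\<close>

lemma reach_rescaled:
  assumes "0 < h"
  shows "reach h = integral (cbox 0 1) (\<lambda>t. 2 * h * sin_angle h (2 * h * t))"
proof -
  have "((\<lambda>t. (2 * h) *\<^sub>R sin_angle h (2 * h * t)) has_integral
      integral {2 * h * 0..2 * h * 1} (sin_angle h)) {0..1}"
    using assms
    by (intro has_integral_substitution [where c = 0 and d = "2 * h"] continuous_on_sin_angle)
      (auto intro!: derivative_eq_intros mult_left_le)
  from integral_unique [OF this] show ?thesis by (simp add: reach_def)
qed

lemma continuous_on_reach: "continuous_on {0<..} reach"
proof -
  have "continuous_on {0<..} (\<lambda>h. integral (cbox 0 1) (\<lambda>t. 2 * h * sin_angle h (2 * h * t)))"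
  proof (rule integral_continuous_on_param)
    show "continuous_on ({0<..} \<times> cbox 0 1) (\<lambda>(h, t). 2 * h * sin_angle h (2 * h * t))"
      unfolding sin_angle_def cos_angle_def split_beta by (intro continuous_intros) auto
  qed
  then show ?thesis
    by (rule continuous_on_cong [OF refl, THEN iffD1, rotated]) (simp add: reach_rescaled)
qed

lemma reach_surj:
  assumes "0 < d"
  obtains h where "0 < h" "reach h = d"
proof -
  \<comment> \<open>\<open>reach_le\<close> at \<open>d / 4\<close> and \<open>reach_ge\<close> at
    \<open>2 * d\<close> bracket \<open>d\<close>; both points are positive, and
    \<open>reach\<close> is continuous between them.\<close>
  have "\<exists>h. d / 4 \<le> h \<and> h \<le> 2 * d \<and> reach h = d"
  proof (rule IVT')
    show "reach (d / 4) \<le> d" using reach_le [of "d / 4"] assms by simp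
    show "d \<le> reach (2 * d)" using reach_ge [of "2 * d"] assms by simp
    show "continuous_on {d / 4..2 * d} reach"
      using assms by (intro continuous_on_subset [OF continuous_on_reach]) auto
  qed (use assms in simp)
  then obtain h where "d / 4 \<le> h" "reach h = d" by blast
  then show thesis using assms by (intro that [of h]) auto
qed

section \<open>The turning curve and its tangent\<close>

locale turning_curve =
  fixes h :: real and e :: "real^3"
  assumes h_pos: "0 < h" and norm_e: "norm e = 1" and e_horizontal: "e $ 3 = 0"
begin

abbreviation u where "u \<equiv> cos_angle h"
abbreviation v where "v \<equiv> sin_angle h"

abbreviation a where "a \<equiv> tanh h"

text \<open>This is \<open>- u'\<close>; by \<open>curvature_curve\<close> it equals the curvature
  times \<open>v\<close> in the interior.\<close>

definition w :: "real \<Rightarrow> real" where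
  "w s = cosh (h - s) / sinh h"

definition X :: "real \<Rightarrow> real" where
  "X s = integral {0..s} v"

text \<open>The antiderivative of \<open>u\<close> that vanishes at 0. It is symmetric about
  \<open>h\<close>, so the curve returns to height 0 at \<open>2 * h\<close>.\<close>

definition Z :: "real \<Rightarrow> real" where
  "Z s = (cosh h - cosh (h - s)) / sinh h"

definition curve :: "real \<Rightarrow> real^3" where
  "curve s = X s *\<^sub>R e + Z s *\<^sub>R e_z"

definition tangent :: "real \<Rightarrow> real^3" where
  "tangent s = v s *\<^sub>R e + u s *\<^sub>R e_z"

lemma sinh_h_pos: "0 < sinh h" using h_pos by simp

lemma e_sq: "(e $ 1)\<^sup>2 + (e $ 2)\<^sup>2 = 1"
  using norm_e e_horizontal by (simp add: norm_eq_1 inner_vec3 power2_eq_square)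

lemma DERIV_u: "(u has_real_derivative - w s) (at s within S)"
  unfolding cos_angle_def [abs_def] w_def using sinh_h_pos
  by (auto intro!: derivative_eq_intros simp: field_simps)

lemma DERIV_w: "(w has_real_derivative - u s) (at s within S)"
  unfolding w_def [abs_def] cos_angle_def using sinh_h_pos
  by (auto intro!: derivative_eq_intros simp: field_simps)

lemma w_pos: "0 < w s"
  unfolding w_def using sinh_h_pos by simp

lemma w_sq: "(w s)\<^sup>2 = (u s)\<^sup>2 + 1 / (sinh h)\<^sup>2"
  unfolding w_def cos_angle_def by (simp add: power_divide cosh_square_eq add_divide_distrib)

lemma DERIV_v:
  assumes "s \<in> {0<..<2 * h}"
  shows "(v has_real_derivative u s * w s / v s) (at s)"
proof -
  have pos: "1 - (u s)\<^sup>2 > 0" using abs_cos_angle_less [of s h] assms by (simp add: abs_square_less_1)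
  have "((\<lambda>s. 1 - (u s)\<^sup>2) has_real_derivative 2 * u s * w s) (at s)"
    by (rule derivative_eq_intros DERIV_u refl | simp)+
  from DERIV_chain2 [OF DERIV_real_sqrt [OF pos] this] show ?thesis
    unfolding sin_angle_def [abs_def] by (rule DERIV_cong) (simp add: divide_simps)
qed

lemma DERIV_X:
  assumes "s \<in> {0..2 * h}"
  shows "(X has_real_derivative v s) (at s within {0..2 * h})"
  unfolding X_def [abs_def]
  using h_pos assms by (intro integral_has_real_derivative continuous_on_sin_angle) auto

lemma DERIV_Z: "(Z has_real_derivative u s) (at s within S)"
  unfolding Z_def [abs_def] cos_angle_def using sinh_h_pos
  by (auto intro!: derivative_eq_intros simp: field_simps)

lemma curve_ends: "curve 0 = 0" "curve (2 * h) = reach h *\<^sub>R e"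
  "tangent 0 = e_z" "tangent (2 * h) = - e_z"
proof -
  have "Z (2 * h) = 0"
  proof -
    have "h - 2 * h = - h" by simp
    then show ?thesis unfolding Z_def by (simp del: minus_diff_eq)
  qed
  then show "curve 0 = 0" "curve (2 * h) = reach h *\<^sub>R e"
    by (simp_all add: curve_def X_def Z_def reach_def)
  show "tangent 0 = e_z" "tangent (2 * h) = - e_z"
    using h_pos by (simp_all add: tangent_def sin_angle_def cos_angle_ends)
qed

lemma curve_derivative:
  assumes "s \<in> {0..2 * h}"
  shows "(curve has_vector_derivative tangent s) (at s within {0..2 * h})"
  unfolding curve_def [abs_def] tangent_def
  by (rule derivative_eq_intros DERIV_X [OF assms] DERIV_Z refl | simp)+

lemma curve_derivative_open:
  assumes "s \<in> {0<..<2 * h}"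
  shows "(curve has_vector_derivative tangent s) (at s)"
proof -
  have "at s within {0..2 * h} = at s" using assms by (intro at_within_interior) auto
  then show ?thesis using curve_derivative [of s] assms by simp
qed

lemma inner_orthonormal: "e \<bullet> e = 1" "e_z \<bullet> e_z = 1" "e \<bullet> e_z = 0" "e_z \<bullet> e = 0"
  using norm_e by (simp_all add: norm_eq_1 inner_vec3 e_horizontal)

lemma norm_tangent:
  assumes "s \<in> {0..2 * h}"
  shows "norm (tangent s) = 1"
  using sin_angle_sq [OF h_pos assms]
  by (simp add: norm_eq_1 tangent_def inner_add_left inner_add_right inner_orthonormal
      flip: power2_eq_square)

section \<open>Curvature and smoothness\<close>

text \<open>In the interior this is \<open>w / v\<close> times \<open>u e - v e_z\<close>, the unit
  tangent turned by a right angle.\<close>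

definition normal :: "real \<Rightarrow> real^3" where
  "normal s = (u s * w s / v s) *\<^sub>R e - w s *\<^sub>R e_z"

lemma tangent_derivative:
  assumes "s \<in> {0<..<2 * h}"
  shows "(tangent has_vector_derivative normal s) (at s)"
  unfolding tangent_def [abs_def] normal_def
  by (rule derivative_eq_intros DERIV_v [OF assms] DERIV_u refl | simp)+

lemma curvature_curve:
  assumes "s \<in> {0<..<2 * h}"
  shows "curvature curve s = w s / v s"
proof -
  have "((\<lambda>t. vector_derivative curve (at t)) has_vector_derivative normal s) (at s)"
    by (rule has_vector_derivative_transform_within_open
        [OF tangent_derivative [OF assms] open_greaterThanLessThan assms])
      (simp add: vector_derivative_at [OF curve_derivative_open])
  then have "curvature curve s = norm (normal s)"
    unfolding curvature_def by (simp add: vector_derivative_at)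
  also have "\<dots> = sqrt ((u s * w s / v s)\<^sup>2 + (w s)\<^sup>2)"
    by (simp add: norm_eq_sqrt_inner normal_def inner_diff_left inner_diff_right inner_orthonormal
        flip: power2_eq_square)
  also have "(u s * w s / v s)\<^sup>2 + (w s)\<^sup>2 = (w s / v s)\<^sup>2 * ((u s)\<^sup>2 + (v s)\<^sup>2)"
    using sin_angle_pos [of s h] assms by (simp add: field_simps)
  also have "(u s)\<^sup>2 + (v s)\<^sup>2 = 1" using sin_angle_sq [of h s] h_pos assms by simp
  finally show ?thesis using sin_angle_pos [of s h] assms w_pos [of s] by (simp add: real_sqrt_mult)
qed

text \<open>
  Closed under differentiation on \<open>(0, 2h)\<close>; this gives the smoothness of the curve.
\<close>

inductive_set coefficient :: "(real \<Rightarrow> real) set" where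
  const: "(\<lambda>_. c) \<in> coefficient"
| X: "X \<in> coefficient"
| Z: "Z \<in> coefficient"
| u: "u \<in> coefficient"
| v: "v \<in> coefficient"
| w: "w \<in> coefficient"
| inv: "(\<lambda>s. 1 / v s) \<in> coefficient"
| add: "f \<in> coefficient \<Longrightarrow> g \<in> coefficient \<Longrightarrow> (\<lambda>s. f s + g s) \<in> coefficient"
| mult: "f \<in> coefficient \<Longrightarrow> g \<in> coefficient \<Longrightarrow> (\<lambda>s. f s * g s) \<in> coefficient"

lemma coefficient_derivative:
  assumes "f \<in> coefficient"
  shows "\<exists>f'\<in>coefficient. \<forall>s\<in>{0<..<2 * h}. (f has_real_derivative f' s) (at s)"
  using assms
proof induction
  case (const c)
  show ?case by (rule bexI [OF _ coefficient.const [of 0]]) simp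
next
  case X
  show ?case
  proof (rule bexI [OF _ coefficient.v], rule ballI)
    fix s assume s: "s \<in> {0<..<2 * h}"
    have "at s within {0..2 * h} = at s" using s by (intro at_within_interior) auto
    then show "(X has_real_derivative v s) (at s)" using DERIV_X [of s] s by simp
  qed
next
  case Z
  show ?case by (rule bexI [OF _ coefficient.u]) (simp add: DERIV_Z)
next
  case u
  show ?case
    by (rule bexI [OF _ coefficient.mult [OF coefficient.const [of "-1"] coefficient.w]])
      (simp add: DERIV_u)
next
  case v
  show ?case
    by (rule bexI [OF _ coefficient.mult [OF coefficient.mult [OF coefficient.u coefficient.w]
          coefficient.inv]])
      (use DERIV_v in simp)
next
  case w
  show ?case
    by (rule bexI [OF _ coefficient.mult [OF coefficient.const [of "-1"] coefficient.u]])
      (simp add: DERIV_w)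
next
  case inv
  show ?case
  proof (rule bexI, rule ballI)
    let ?i = "\<lambda>s. 1 / v s"
    \<comment> \<open>\<open>(1 / v)' = - v' / v\<^sup>2 = - u * w / v ^ 3\<close>, written as a
      product of coefficients.\<close>
    show "(\<lambda>s. (-1 * (u s * w s)) * (?i s * (?i s * ?i s))) \<in> coefficient"
      by (intro coefficient.intros)
    fix s assume s: "s \<in> {0<..<2 * h}"
    then have "v s > 0" by (simp add: sin_angle_pos)
    then show "(?i has_real_derivative (-1 * (u s * w s)) * (?i s * (?i s * ?i s))) (at s)"
      by (auto intro!: derivative_eq_intros DERIV_v [OF s] simp: field_simps)
  qed
next
  case (add f g)
  then obtain f' g' where "f' \<in> coefficient" "g' \<in> coefficient"
    "\<forall>s\<in>{0<..<2 * h}. (f has_real_derivative f' s) (at s)"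
    "\<forall>s\<in>{0<..<2 * h}. (g has_real_derivative g' s) (at s)" by blast
  then show ?case
    by (intro bexI [OF _ coefficient.add [of f' g']] ballI DERIV_add) auto
next
  case (mult f g)
  then obtain f' g' where "f' \<in> coefficient" "g' \<in> coefficient"
    "\<forall>s\<in>{0<..<2 * h}. (f has_real_derivative f' s) (at s)"
    "\<forall>s\<in>{0<..<2 * h}. (g has_real_derivative g' s) (at s)" by blast
  then show ?case
    by (intro bexI [OF _ coefficient.add [OF coefficient.mult [OF _ mult.hyps(2), of f']
          coefficient.mult [OF _ mult.hyps(1), of g']]] ballI DERIV_mult) auto
qed

lemma smooth_curve: "smooth_on_open curve {0<..<2 * h}"
proof -
  let ?D = "\<lambda>g t. vector_derivative g (at t)"
  let ?I = "{0<..<2 * h}"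
  \<comment> \<open>Stated for every \<open>g\<close> that agrees with such a combination on
    \<open>?I\<close>, because the iterated derivatives are controlled only there.\<close>
  have step: "g differentiable_on ?I \<and>
      (\<exists>f1\<in>coefficient. \<exists>f2\<in>coefficient. \<forall>s\<in>?I. ?D g s = f1 s *\<^sub>R e + f2 s *\<^sub>R e_z)"
    if f: "f1 \<in> coefficient" "f2 \<in> coefficient"
      and g: "\<forall>s\<in>?I. g s = f1 s *\<^sub>R e + f2 s *\<^sub>R e_z" for f1 f2 g
  proof -
    obtain f1' f2' where f': "f1' \<in> coefficient" "f2' \<in> coefficient"
      "\<forall>s\<in>?I. (f1 has_real_derivative f1' s) (at s)"
      "\<forall>s\<in>?I. (f2 has_real_derivative f2' s) (at s)"
      using coefficient_derivative [OF f(1)] coefficient_derivative [OF f(2)] by blast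
    have deriv: "(g has_vector_derivative f1' s *\<^sub>R e + f2' s *\<^sub>R e_z) (at s)" if s: "s \<in> ?I" for s
    proof (rule has_vector_derivative_transform_within_open [OF _ open_greaterThanLessThan s])
      show "((\<lambda>s. f1 s *\<^sub>R e + f2 s *\<^sub>R e_z) has_vector_derivative
          f1' s *\<^sub>R e + f2' s *\<^sub>R e_z) (at s)"
        by (rule derivative_eq_intros bspec [OF f'(3) s] bspec [OF f'(4) s] refl | simp)+
    qed (use g in auto)
    have "g differentiable_on ?I"
      by (intro differentiable_at_imp_differentiable_on differentiableI_vector [OF deriv])
    moreover have "\<forall>s\<in>?I. ?D g s = f1' s *\<^sub>R e + f2' s *\<^sub>R e_z"
      using deriv by (auto intro: vector_derivative_at)
    ultimately show ?thesis using f'(1,2) by blast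
  qed
  have form: "\<exists>f1\<in>coefficient. \<exists>f2\<in>coefficient.
      \<forall>s\<in>?I. (?D ^^ k) curve s = f1 s *\<^sub>R e + f2 s *\<^sub>R e_z" for k
  proof (induction k)
    case 0
    show ?case
      by (rule bexI [OF _ coefficient.X], rule bexI [OF _ coefficient.Z]) (simp add: curve_def)
  next
    case (Suc k)
    then show ?case using step by auto
  qed
  show ?thesis
    unfolding smooth_on_open_def using form step by blast
qed

lemma admissible_curve:
  "P_curve_admissible (reach h *\<^sub>R e) (- e_z) (2 * h) curve tangent"
  unfolding P_curve_admissible_def
proof (intro conjI ballI)
  show "continuous_on {0..2 * h} tangent"
    unfolding tangent_def [abs_def] using h_pos
    by (intro continuous_intros continuous_on_sin_angle continuous_on_cos_angle) auto
qed (use h_pos in \<open>auto simp: curve_derivative norm_tangent smooth_curve curve_ends\<close>)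

section \<open>Equality in the calibration\<close>

lemma a_bounds: "0 < a" "a < 1"
  using h_pos tanh_real_lt_1 by auto

lemma a_sq: "a\<^sup>2 * (1 + 1 / (sinh h)\<^sup>2) = 1"
proof -
  have "(sinh h)\<^sup>2 \<noteq> - 1" by (smt (verit) zero_le_power2)
  then show ?thesis
    using sinh_h_pos by (simp add: tanh_def power_divide cosh_square_eq divide_simps add_eq_0_iff)
qed

text \<open>In the geodesic lift below, \<open>a * v\<close> is \<open>lam3\<close> and
  \<open>a * w\<close> is the length of \<open>(lam4, lam5)\<close>; this is the normalization of
  the momentum.\<close>

lemma w_sq_v_sq:
  assumes "s \<in> {0..2 * h}"
  shows "a\<^sup>2 * ((v s)\<^sup>2 + (w s)\<^sup>2) = 1"
proof -
  have "(v s)\<^sup>2 + (w s)\<^sup>2 = 1 + 1 / (sinh h)\<^sup>2"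
    by (simp add: w_sq sin_angle_sq h_pos assms del: atLeastAtMost_iff)
  with a_sq show ?thesis by simp
qed

text \<open>The cost density of the curve is thus \<open>1 / lam3\<close> of its lift, unbounded
  near both cusps.\<close>

lemma sqrt_one_plus_curvature:
  assumes "s \<in> {0<..<2 * h}"
  shows "sqrt (1 + (curvature curve s)\<^sup>2) = 1 / (a * v s)"
proof -
  have v: "0 < v s" using sin_angle_pos [of s h] assms by auto
  have "1 + (curvature curve s)\<^sup>2 = a\<^sup>2 * ((v s)\<^sup>2 + (w s)\<^sup>2) / (a * v s)\<^sup>2"
    using v a_bounds by (simp add: curvature_curve [OF assms] field_simps)
  also have "\<dots> = (1 / (a * v s))\<^sup>2"
    using assms by (subst w_sq_v_sq) (auto simp: power_divide)
  finally have "1 + (curvature curve s)\<^sup>2 = (1 / (a * v s))\<^sup>2" .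
  then show ?thesis using v a_bounds by simp
qed

text \<open>Gives the numerator of \<open>slope\<close> along the curve.\<close>

lemma sqrt_one_minus_calibrated:
  assumes "s \<in> {0..2 * h}"
  shows "sqrt (1 - a\<^sup>2 * (1 - (u s)\<^sup>2)) = a * w s"
proof -
  have "1 - a\<^sup>2 * (1 - (u s)\<^sup>2) = (a * w s)\<^sup>2"
    using w_sq_v_sq [OF assms] sin_angle_sq [OF h_pos assms] by (simp add: power_mult_distrib algebra_simps)
  then show ?thesis using a_bounds w_pos [of s] by simp
qed

text \<open>The integrand is the derivative of \<open>a * X s - \<Gamma> (u s)\<close>, so the
  integral is exactly the bound of \<open>P_curve_cost_lower_bound\<close> for this end
  point.\<close>

lemma integral_calibration_form:
  assumes "\<epsilon> > 0" and \<Gamma>: "\<And>w. w \<in> {-1..1} \<Longrightarrow> (\<Gamma> has_real_derivative slope a \<epsilon> w) (at w)"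
  shows "(\<integral>\<^sup>+ s\<in>{0..2 * h}. ennreal (a * v s + slope a \<epsilon> (u s) * w s) \<partial>lborel)
       = ennreal (a * reach h + \<Gamma> 1 - \<Gamma> (-1))"
proof -
  have u: "u s \<in> {-1..1}" if "s \<in> {0..2 * h}" for s
    using cos_angle_sq_le [OF h_pos that] by (simp add: abs_square_le_1 abs_le_iff)
  have "((\<lambda>s. a * v s + slope a \<epsilon> (u s) * w s) has_integral
      (a * X (2 * h) - \<Gamma> (u (2 * h))) - (a * X 0 - \<Gamma> (u 0))) {0..2 * h}"
  proof (rule fundamental_theorem_of_calculus)
    fix s assume s: "s \<in> {0..2 * h}"
    have "((\<lambda>s. \<Gamma> (u s)) has_real_derivative slope a \<epsilon> (u s) * - w s) (at s within {0..2 * h})"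
      by (rule DERIV_chain2 [where f = \<Gamma> and g = u, OF \<Gamma> [OF u [OF s]] DERIV_u])
    from DERIV_diff [OF DERIV_cmult [OF DERIV_X [OF s], of a] this]
    show "((\<lambda>s. a * X s - \<Gamma> (u s)) has_vector_derivative a * v s + slope a \<epsilon> (u s) * w s)
        (at s within {0..2 * h})"
      by (simp add: has_real_derivative_iff_has_vector_derivative)
  qed (use h_pos in simp)
  moreover have "0 \<le> a * v s + slope a \<epsilon> (u s) * w s" if "s \<in> {0..2 * h}" for s
    using a_bounds sin_angle_nonneg [OF h_pos that] w_pos [of s] sqrt_one_minus_calibrated [OF that] \<open>\<epsilon> > 0\<close>
    by (simp add: slope_def)
  ultimately have "(\<integral>\<^sup>+ s\<in>{0..2 * h}. ennreal (a * v s + slope a \<epsilon> (u s) * w s) \<partial>lborel)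
      = ennreal ((a * X (2 * h) - \<Gamma> (u (2 * h))) - (a * X 0 - \<Gamma> (u 0)))"
    by (intro nn_integral_has_integral_lebesgue')
  also have "(a * X (2 * h) - \<Gamma> (u (2 * h))) - (a * X 0 - \<Gamma> (u 0)) = a * reach h + \<Gamma> 1 - \<Gamma> (-1)"
    using h_pos by (simp add: X_def cos_angle_ends reach_def)
  finally show ?thesis .
qed

text \<open>
  The integrand of the cost of the curve is the limit of the calibration forms as \<open>\<epsilon> \<rightarrow> 0\<close>,
  and Fatou's lemma carries the lower bounds over.
\<close>

lemma curve_optimal:
  assumes adm: "P_curve_admissible (reach h *\<^sub>R e) (- e_z) L x n"
  shows "P_curve_cost (2 * h) curve \<le> P_curve_cost L x"
proof -
  define \<epsilon> where "\<epsilon> k = 1 / real (Suc k)" for k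
  have \<epsilon>: "\<epsilon> k > 0" for k by (simp add: \<epsilon>_def)
  have \<epsilon>_lim: "\<epsilon> \<longlonglongrightarrow> 0" unfolding \<epsilon>_def [abs_def] by real_asymp
  have "\<forall>k. \<exists>\<Gamma>. \<forall>w\<in>{-1..1}. (\<Gamma> has_real_derivative slope a (\<epsilon> k) w) (at w)"
    using slope_antiderivative [OF \<epsilon>] by metis
  then obtain \<Gamma> where \<Gamma>: "\<And>k w. w \<in> {-1..1} \<Longrightarrow> (\<Gamma> k has_real_derivative slope a (\<epsilon> k) w) (at w)"
    by metis
  define F where "F k s = ennreal (a * v s + slope a (\<epsilon> k) (u s) * w s) * indicator {0<..<2 * h} s"
    for k s
  have meas: "F k \<in> borel_measurable lborel" for k
  proof -
    have "continuous_on UNIV (\<lambda>s. a * v s + slope a (\<epsilon> k) (u s) * w s)"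
      using h_pos sinh_h_pos unfolding w_def
      by (intro continuous_intros continuous_on_sin_angle continuous_on_cos_angle
          continuous_on_compose2 [OF continuous_on_slope [OF \<epsilon>]]) auto
    then have [measurable]: "(\<lambda>s. a * v s + slope a (\<epsilon> k) (u s) * w s) \<in> borel_measurable borel"
      by (rule borel_measurable_continuous_onI)
    show ?thesis unfolding F_def [abs_def] by measurable
  qed
  have lim: "liminf (\<lambda>k. F k s)
      = ennreal (sqrt (1 + (curvature curve s)\<^sup>2)) * indicator {0<..<2 * h} s" for s
  proof (cases "s \<in> {0<..<2 * h}")
    case True
    then have s: "s \<in> {0..2 * h}" and v: "0 < v s" using sin_angle_pos [of s h] by auto
    have v2: "(v s)\<^sup>2 = 1 - (u s)\<^sup>2" by (rule sin_angle_sq [OF h_pos s])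
    \<comment> \<open>As \<open>\<epsilon> k\<close> tends to 0, the slope tends to
      \<open>a * w / v\<close>, and \<open>a * v + a * w\<^sup>2 / v\<close> is
      \<open>1 / (a * v)\<close> by \<open>w_sq_v_sq\<close>.\<close>
    have "(\<lambda>k. a * v s + a * w s / sqrt ((v s)\<^sup>2 + \<epsilon> k) * w s)
        \<longlonglongrightarrow> a * v s + a * w s / sqrt ((v s)\<^sup>2 + 0) * w s"
      using v by (intro tendsto_intros \<epsilon>_lim) auto
    also have "a * v s + a * w s / sqrt ((v s)\<^sup>2 + 0) * w s = a\<^sup>2 * ((v s)\<^sup>2 + (w s)\<^sup>2) / (a * v s)"
      using v a_bounds by (simp add: field_simps power2_eq_square)
    also have "\<dots> = sqrt (1 + (curvature curve s)\<^sup>2)"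
      by (simp only: w_sq_v_sq [OF s] sqrt_one_plus_curvature [OF True])
    also have "(\<lambda>k. a * v s + a * w s / sqrt ((v s)\<^sup>2 + \<epsilon> k) * w s)
        = (\<lambda>k. a * v s + slope a (\<epsilon> k) (u s) * w s)"
      unfolding slope_def sqrt_one_minus_calibrated [OF s] unfolding v2 [symmetric] by simp
    finally have "(\<lambda>k. F k s) \<longlonglongrightarrow> ennreal (sqrt (1 + (curvature curve s)\<^sup>2))"
      unfolding F_def using True by (simp add: tendsto_ennrealI)
    from lim_imp_Liminf [OF _ this] show ?thesis using True by simp
  qed (simp add: F_def Liminf_const)
  have "P_curve_cost (2 * h) curve = (\<integral>\<^sup>+ s. liminf (\<lambda>k. F k s) \<partial>lborel)"
    unfolding lim P_curve_cost_def ..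
  also have "\<dots> \<le> liminf (\<lambda>k. integral\<^sup>N lborel (F k))" by (rule nn_integral_liminf [OF meas])
  also have "\<dots> \<le> liminf (\<lambda>k::nat. P_curve_cost L x)"
  proof (intro Liminf_mono always_eventually allI)
    fix k
    have "integral\<^sup>N lborel (F k)
        \<le> (\<integral>\<^sup>+ s\<in>{0..2 * h}. ennreal (a * v s + slope a (\<epsilon> k) (u s) * w s) \<partial>lborel)"
      unfolding F_def by (intro nn_integral_mono) (auto simp: indicator_def)
    also have "\<dots> = ennreal (a * ((reach h *\<^sub>R e) \<bullet> e) + \<Gamma> k 1 - \<Gamma> k (-1))"
      unfolding inner_scaleR_left inner_orthonormal mult_1_right
      by (intro integral_calibration_form \<epsilon> \<Gamma>)
    also have "\<dots> \<le> P_curve_cost L x"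
      using a_bounds
      by (intro P_curve_cost_lower_bound [OF adm norm_e _ _ _ \<epsilon> [of k]] \<Gamma>) (auto simp: inner_orthonormal)
    finally show "integral\<^sup>N lborel (F k) \<le> P_curve_cost L x" .
  qed
  also have "\<dots> = P_curve_cost L x" by (simp add: Liminf_const)
  finally show ?thesis .
qed

section \<open>The lift to a sub-Riemannian geodesic\<close>

text \<open>The initial momentum has \<open>(lam1, lam2)\<close> equal to \<open>a * e\<close> and
  \<open>(lam4, lam5)\<close> equal to the unit vector \<open>(- e $ 2, e $ 1)\<close>, so the start
  is a cusp. The common factor is
  \<open>cosh s - a * sinh s = cosh (h - s) / cosh h\<close>.\<close>

lemma lam_curve:
  "lam5 (e $ 1 * a) (e $ 1) s = a * w s * e $ 1"
  "lam4 (e $ 2 * a) (- (e $ 2)) s = - (a * w s * e $ 2)"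
proof -
  have "cosh s - a * sinh s = a * w s"
    using sinh_h_pos by (simp add: tanh_def w_def cosh_diff field_simps)
  then have *: "a * w s * c = c * cosh s - c * a * sinh s" for c
    by (simp add: algebra_simps)
  show "lam5 (e $ 1 * a) (e $ 1) s = a * w s * e $ 1"
    "lam4 (e $ 2 * a) (- (e $ 2)) s = - (a * w s * e $ 2)"
    unfolding lam5_def lam4_def * by simp_all
qed

lemma lam3_curve: "lam3 (e $ 1 * a) (e $ 2 * a) (- (e $ 2)) (e $ 1) s = a * v s"
proof -
  have "(a * w s * e $ 2)\<^sup>2 + (a * w s * e $ 1)\<^sup>2 = a\<^sup>2 * (w s)\<^sup>2"
    using e_sq by algebra
  moreover have "1 - a\<^sup>2 * (w s)\<^sup>2 = a\<^sup>2 * (1 - (u s)\<^sup>2)"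
    using a_sq unfolding w_sq by (simp add: algebra_simps)
  ultimately have "1 - (a * w s * e $ 2)\<^sup>2 - (a * w s * e $ 1)\<^sup>2 = a\<^sup>2 * (1 - (u s)\<^sup>2)" by linarith
  then show ?thesis
    using a_bounds by (simp add: lam3_def lam_curve sin_angle_def real_sqrt_mult)
qed

text \<open>Rodrigues' formula for the rotation about the horizontal axis
  \<open>e_z \<times> e\<close> by the angle with cosine \<open>u s\<close> and sine
  \<open>v s\<close>. The matrices are the projection to the axis, the projection to the plane of
  \<open>e\<close> and \<open>e_z\<close>, and the cross product with the axis.\<close>

definition frame :: "real \<Rightarrow> real^3^3" where
  "frame s =
     vector [vector [1 - (e $ 1)\<^sup>2, - (e $ 1 * e $ 2), 0],
             vector [- (e $ 1 * e $ 2), 1 - (e $ 2)\<^sup>2, 0],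
             vector [0, 0, 0]]
     + u s *\<^sub>R
     vector [vector [(e $ 1)\<^sup>2, e $ 1 * e $ 2, 0],
             vector [e $ 1 * e $ 2, (e $ 2)\<^sup>2, 0],
             vector [0, 0, 1]]
     + v s *\<^sub>R
     vector [vector [0, 0, e $ 1],
             vector [0, 0, e $ 2],
             vector [- (e $ 1), - (e $ 2), 0]]"

lemma frame_nth:
  "frame s $ 1 $ 1 = 1 - (e $ 1)\<^sup>2 + u s * (e $ 1)\<^sup>2"
  "frame s $ 1 $ 2 = - (e $ 1 * e $ 2) + u s * (e $ 1 * e $ 2)"
  "frame s $ 1 $ 3 = v s * e $ 1"
  "frame s $ 2 $ 1 = - (e $ 1 * e $ 2) + u s * (e $ 1 * e $ 2)"
  "frame s $ 2 $ 2 = 1 - (e $ 2)\<^sup>2 + u s * (e $ 2)\<^sup>2"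
  "frame s $ 2 $ 3 = v s * e $ 2"
  "frame s $ 3 $ 1 = - (v s * e $ 1)"
  "frame s $ 3 $ 2 = - (v s * e $ 2)"
  "frame s $ 3 $ 3 = u s"
  by (simp_all add: frame_def)

lemma frame_e_z: "frame s *v e_z = tangent s"
  by (simp add: vec_eq_iff forall_3 mult_e_z_nth frame_nth tangent_def e_horizontal)

lemma frame_rotation:
  assumes "s \<in> {0..2 * h}"
  shows "orthogonal_matrix (frame s)" "det (frame s) = 1"
proof -
  note vs = sin_angle_sq [OF h_pos assms]
  show "orthogonal_matrix (frame s)"
    unfolding orthogonal_matrix
    using e_sq vs
    by (simp add: vec_eq_iff forall_3 matrix_matrix_mult_def transpose_def sum_3 mat_def frame_nth)
      (intro conjI; algebra)
  show "det (frame s) = 1"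
    unfolding det_3 frame_nth using e_sq vs by algebra
qed

lemma frame_derivative:
  assumes "s \<in> {0<..<2 * h}"
  shows "(frame has_vector_derivative
    (1 / (a * v s)) *\<^sub>R (frame s ** omega_mat (- (a * w s * e $ 2)) (a * w s * e $ 1))) (at s)"
proof -
  \<comment> \<open>\<open>t\<close> is the curvature. Substituting \<open>w s = t * v s\<close>
    removes the divisions and leaves polynomial identities in the matrix entries.\<close>
  define t where "t = w s / v s"
  have v: "v s \<noteq> 0" using sin_angle_pos [of s h] assms by auto
  then have t: "w s = t * v s" by (simp add: t_def)
  have "(v has_real_derivative u s * t) (at s)"
    using DERIV_v [OF assms] by (simp add: t_def)
  note derivs = this DERIV_u [of s UNIV, unfolded t]
  have "(1 / (a * v s)) *\<^sub>R (frame s ** omega_mat (- (a * w s * e $ 2)) (a * w s * e $ 1))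
      = frame s ** omega_mat (- (t * e $ 2)) (t * e $ 1)"
    using v a_bounds
    by (simp add: vec_eq_iff forall_3 matrix_matrix_mult_def omega_mat_def sum_3 t divide_simps)
      (simp add: algebra_simps)
  moreover have "(frame has_vector_derivative frame s ** omega_mat (- (t * e $ 2)) (t * e $ 1)) (at s)"
    unfolding frame_def [abs_def]
    by (rule derivative_eq_intros derivs refl)+
      (fold frame_def, use e_sq in \<open>simp add: vec_eq_iff forall_3 matrix_matrix_mult_def
        omega_mat_def sum_3 frame_nth t power2_eq_square\<close>, intro conjI; algebra)
  ultimately show ?thesis by (simp only:)
qed

lemma sr_geodesic_curve:
  "sr_geodesic (e $ 1 * a) (e $ 2 * a) (- (e $ 2)) (e $ 1) (2 * h) curve frame"
  unfolding sr_geodesic_def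
proof (intro conjI ballI)
  show "(e $ 1 * a, e $ 2 * a, lam3 (e $ 1 * a) (e $ 2 * a) (- (e $ 2)) (e $ 1) 0) \<noteq> (0, 0, 0)"
    using e_sq a_bounds by auto
  show "(- (e $ 2))\<^sup>2 + (e $ 1)\<^sup>2 \<le> 1" using e_sq by simp
  show "0 \<le> 2 * h" using h_pos by simp
  show "ereal (2 * h) \<le> s_max (e $ 1 * a) (e $ 2 * a) (- (e $ 2)) (e $ 1)"
    unfolding s_max_def lam3_curve
  proof (rule Inf_greatest)
    fix t assume "t \<in> ereal ` {s. 0 < s \<and> a * v s = 0}"
    then obtain s where "t = ereal s" "0 < s" "v s = 0" using a_bounds by auto
    \<comment> \<open>\<open>v\<close> is positive before \<open>2 * h\<close>, so every positive
      zero is at least \<open>2 * h\<close>.\<close>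
    then show "ereal (2 * h) \<le> t" using sin_angle_pos [of s h] by force
  qed
  show "(lam4 (e $ 2 * a) (- (e $ 2)) s)\<^sup>2 + (lam5 (e $ 1 * a) (e $ 1) s)\<^sup>2 \<le> 1"
    if "s \<in> {0..2 * h}" for s
  proof -
    have "(a * w s * e $ 2)\<^sup>2 + (a * w s * e $ 1)\<^sup>2 = 1 - (a * v s)\<^sup>2"
      using e_sq w_sq_v_sq [OF that] by algebra
    then show ?thesis by (simp add: lam_curve)
  qed
  show "continuous_on {0..2 * h} curve"
    using curve_derivative
    by (meson has_vector_derivative_continuous continuous_on_eq_continuous_within)
  show "continuous_on {0..2 * h} frame"
    unfolding frame_def [abs_def] using h_pos
    by (intro continuous_intros continuous_on_sin_angle continuous_on_cos_angle) auto
  show "frame 0 = mat 1"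
    using h_pos by (simp add: vec_eq_iff forall_3 frame_nth mat_def cos_angle_ends sin_angle_def)
qed (use frame_rotation frame_derivative curve_derivative_open in
    \<open>auto simp: curve_ends frame_e_z lam3_curve lam_curve\<close>)

lemma P_curve_solution_curve:
  "P_curve_solution (reach h *\<^sub>R e) (- e_z) (2 * h) curve tangent"
  unfolding P_curve_solution_def P_curve_stationary_def
  using admissible_curve sr_geodesic_curve curve_optimal
  by (auto simp: curve_ends frame_e_z intro!: exI)

end


subsection \<open>End points with reversed tangent\<close>

text \<open>The condition \<open>x1 \<noteq> 0\<close> appears because a reversing geodesic cannot
  close up, by \<open>end_point_nonzero\<close>. Solutions are stationary, so necessity is shown for
  stationary curves and sufficiency by exhibiting a solution.\<close>

theorem corollary9:
  fixes x1 :: "real^3"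
  shows "((\<exists>L x n. P_curve_solution x1 (- e_z) L x n) \<longleftrightarrow> x1 \<bullet> e_z = 0 \<and> x1 \<noteq> 0) \<and>
         ((\<exists>L x n. P_curve_stationary x1 (- e_z) L x n) \<longleftrightarrow> x1 \<bullet> e_z = 0 \<and> x1 \<noteq> 0) \<and>
         (\<forall>l1 l2 l4 l5 L x R.
            sr_geodesic l1 l2 l4 l5 L x R \<and> x L = x1 \<and> R L *v e_z = - e_z \<longrightarrow>
            departs_from_cusp l1 l2 l4 l5 \<and> ends_in_cusp l1 l2 l4 l5 L)"
proof -
  have reversing: "reversing_geodesic l1 l2 l4 l5 L x R"
    if "sr_geodesic l1 l2 l4 l5 L x R" "R L *v e_z = - e_z" for l1 l2 l4 l5 L x R
    using that by unfold_locales
  have solution: "\<exists>L x n. P_curve_solution x1 (- e_z) L x n" if "x1 \<bullet> e_z = 0" "x1 \<noteq> 0"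
  proof -
    \<comment> \<open>With \<open>reach h = norm x1\<close> and \<open>e\<close> the direction of
      \<open>x1\<close>, the turning curve ends exactly at \<open>x1\<close>.\<close>
    obtain h where h: "0 < h" "reach h = norm x1" using reach_surj [of "norm x1"] \<open>x1 \<noteq> 0\<close> by auto
    interpret turning_curve h "x1 /\<^sub>R norm x1"
      using that h by unfold_locales (auto simp: inner_e_z)
    show ?thesis using P_curve_solution_curve \<open>x1 \<noteq> 0\<close> by (auto simp: h)
  qed
  have stationary: "P_curve_solution x1 (- e_z) L x n \<Longrightarrow> P_curve_stationary x1 (- e_z) L x n" for L x n
    by (simp add: P_curve_solution_def)
  have necessary: "x1 \<bullet> e_z = 0 \<and> x1 \<noteq> 0" if stat: "P_curve_stationary x1 (- e_z) L x n" for L x n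
  proof -
    obtain l1 l2 l4 l5 R where geo: "sr_geodesic l1 l2 l4 l5 L x R"
      and n: "\<forall>s\<in>{0..L}. n s = R s *v e_z" and ends: "x L = x1" "n L = - e_z"
      using stat unfolding P_curve_stationary_def by blast
    have "0 \<le> L" using geo by (simp add: sr_geodesic_def)
    then have "R L *v e_z = - e_z" using n ends by auto
    then interpret reversing_geodesic l1 l2 l4 l5 L x R using geo by (intro reversing)
    show ?thesis using end_point_horizontal end_point_nonzero ends by simp
  qed
  have cusps: "departs_from_cusp l1 l2 l4 l5 \<and> ends_in_cusp l1 l2 l4 l5 L"
    if "sr_geodesic l1 l2 l4 l5 L x R" "R L *v e_z = - e_z" for l1 l2 l4 l5 L x R
  proof -
    interpret reversing_geodesic l1 l2 l4 l5 L x R using that by (rule reversing)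
    show ?thesis by (simp add: departs_from_cusp_def ends_in_cusp_def m3_ends s_max_eq)
  qed
  show ?thesis using solution stationary necessary cusps by blast
qed

end
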